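(* Let $T=(T_t)_{t\in\mathbb{R}_+}$ be a strongly continuous CP-semigroup on a unital $C^*$-algebra $\mathcal{B}$. Then $T$ is spatial if and only if it has a Christensen-Evans generator, that is, if and only if $T$ is uniformly continuous and there exist a correspondence $F$ over $\mathcal{B}$, an element $\zeta\in F$ and an element $\beta\in\mathcal{B}$ such that the generator $L=\frac{d}{dt}\big|_{t=0}T_t$ of $T$ is given by $$L(b)=\langle\zeta,b\zeta\rangle+b\beta+\beta^*b\qquad(b\in\mathcal{B}).$$
   Context: A CP-semigroup on $\mathcal{B}$ is a one-parameter semigroup $T=(T_t)_{t\in\mathbb{R}_+}$ ($\mathbb{R}_+=[0,\infty)$, $T_0=\mathrm{id}$) of completely positive maps on $\mathcal{B}$. It is strongly continuous if $t\mapsto T_t(b)$ is norm continuous for every $b\in\mathcal{B}$, and uniformly continuous if $t\mapsto T_t$ is continuous in the operator norm of bounded maps on $\mathcal{B}$. A strongly continuous CP-semigroup $T$ is spatial if there is a norm continuous semigroup $c=(c_t)_{t\in\mathbb{R}_+}$ of elements of $\mathcal{B}$ ($c_sc_t=c_{s+t}$, $c_0=\mathbf{1}$) such that for every $t\in\mathbb{R}_+$ the map $b\mapsto T_t(b)-c_t^*bc_t$ on $\mathcal{B}$ is completely positive. A correspondence over $\mathcal{B}$ is a right Hilbert $\mathcal{B}$-module (with $\mathcal{B}$-valued inner product linear in the second argument) with a nondegenerate (unital) left action of $\mathcal{B}$ by adjointable operators. *)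

theory Defs
  imports "HOL-Analysis.Analysis" "HOL-Algebra.Ring"
begin

section \<open>Unital C*-algebras and completely positive maps\<close>

text \<open>A (nonzero) unital C*-algebra. The real Banach algebra structure comes from the library
  classes; the complex structure extends it.\<close>

class cstar_algebra = real_normed_algebra_1 + banach +
  fixes scaleC :: "complex \<Rightarrow> 'a \<Rightarrow> 'a"  (infixr "*\<^sub>C" 75)
    and star :: "'a \<Rightarrow> 'a"
  assumes scaleC_of_real: "complex_of_real r *\<^sub>C x = r *\<^sub>R x"
    and scaleC_add_right: "a *\<^sub>C (x + y) = a *\<^sub>C x + a *\<^sub>C y"
    and scaleC_add_left: "(a + b) *\<^sub>C x = a *\<^sub>C x + b *\<^sub>C x"
    and scaleC_scaleC: "a *\<^sub>C (b *\<^sub>C x) = (a * b) *\<^sub>C x"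
    and mult_scaleC_left: "(a *\<^sub>C x) * y = a *\<^sub>C (x * y)"
    and mult_scaleC_right: "x * (a *\<^sub>C y) = a *\<^sub>C (x * y)"
    and norm_scaleC: "norm (a *\<^sub>C x) = cmod a * norm x"
    and star_add: "star (x + y) = star x + star y"
    and star_scaleC: "star (a *\<^sub>C x) = cnj a *\<^sub>C star x"
    and star_mult: "star (x * y) = star y * star x"
    and star_star: "star (star x) = x"
    and cstar_identity: "norm (star x * x) = (norm x)\<^sup>2"

definition cstar_pos :: "'b::cstar_algebra \<Rightarrow> bool" where
  "cstar_pos a \<longleftrightarrow> (\<exists>x. a = star x * x)"

text \<open>The entries \<open>A i j\<close> with \<open>i, j < n\<close> represent an element of the C*-algebra of \<open>n \<times> n\<close>
  matrices over \<open>'b\<close>; other entries are irrelevant. Positivity there again means \<open>A = X\<^sup>* X\<close>.\<close>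

definition matrix_pos :: "nat \<Rightarrow> (nat \<Rightarrow> nat \<Rightarrow> 'b::cstar_algebra) \<Rightarrow> bool" where
  "matrix_pos n A \<longleftrightarrow> (\<exists>X. \<forall>i<n. \<forall>j<n. A i j = (\<Sum>k<n. star (X k i) * X k j))"

definition complex_linear :: "('b::cstar_algebra \<Rightarrow> 'b) \<Rightarrow> bool" where
  "complex_linear \<phi> \<longleftrightarrow>
     (\<forall>x y. \<phi> (x + y) = \<phi> x + \<phi> y) \<and> (\<forall>a x. \<phi> (a *\<^sub>C x) = a *\<^sub>C \<phi> x)"

definition completely_positive :: "('b::cstar_algebra \<Rightarrow> 'b) \<Rightarrow> bool" where
  "completely_positive \<phi> \<longleftrightarrow> complex_linear \<phi> \<and>
     (\<forall>n A. matrix_pos n A \<longrightarrow> matrix_pos n (\<lambda>i j. \<phi> (A i j)))"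


section \<open>CP-semigroups\<close>

text \<open>Semigroups indexed by \<open>[0, \<infinity>)\<close> are functions on \<^typ>\<open>real\<close>; values at negative
  times are irrelevant.\<close>

definition cp_semigroup :: "(real \<Rightarrow> 'b::cstar_algebra \<Rightarrow> 'b) \<Rightarrow> bool" where
  "cp_semigroup T \<longleftrightarrow> (\<forall>t\<ge>0. completely_positive (T t)) \<and> T 0 = id \<and>
     (\<forall>s\<ge>0. \<forall>t\<ge>0. T (s + t) = T s \<circ> T t)"

definition strongly_continuous :: "(real \<Rightarrow> 'b::cstar_algebra \<Rightarrow> 'b) \<Rightarrow> bool" where
  "strongly_continuous T \<longleftrightarrow> (\<forall>b. continuous_on {0..} (\<lambda>t. T t b))"

text \<open>Boundedness is demanded explicitly because \<^const>\<open>Blinfun\<close> is unspecified on maps that are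
  not bounded; the norm of the type of bounded linear maps is the operator norm.\<close>

definition uniformly_continuous :: "(real \<Rightarrow> 'b::cstar_algebra \<Rightarrow> 'b) \<Rightarrow> bool" where
  "uniformly_continuous T \<longleftrightarrow>
     (\<forall>t\<ge>0. bounded_linear (T t)) \<and> continuous_on {0..} (\<lambda>t. Blinfun (T t))"

definition spatial :: "(real \<Rightarrow> 'b::cstar_algebra \<Rightarrow> 'b) \<Rightarrow> bool" where
  "spatial T \<longleftrightarrow> (\<exists>c :: real \<Rightarrow> 'b.
     c 0 = 1 \<and> (\<forall>s\<ge>0. \<forall>t\<ge>0. c (s + t) = c s * c t) \<and> continuous_on {0..} c \<and>
     (\<forall>t\<ge>0. completely_positive (\<lambda>b. T t b - star (c t) * b * c t)))"

definition is_generator ::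
    "('b::cstar_algebra \<Rightarrow> 'b) \<Rightarrow> (real \<Rightarrow> 'b \<Rightarrow> 'b) \<Rightarrow> bool" where
  "is_generator L T \<longleftrightarrow> (\<forall>b. ((\<lambda>t. T t b) has_vector_derivative L b) (at 0 within {0..}))"


section \<open>Correspondences\<close>

text \<open>The additive group is provided by the library's record \<^typ>\<open>'f ring\<close>, whose
  multiplicative components are not used (as in the library's record for modules).\<close>

record ('b, 'f) bimodule = "'f ring" +
  csmult :: "complex \<Rightarrow> 'f \<Rightarrow> 'f"
  ract :: "'f \<Rightarrow> 'b \<Rightarrow> 'f"
  lact :: "'b \<Rightarrow> 'f \<Rightarrow> 'f"
  ip :: "'f \<Rightarrow> 'f \<Rightarrow> 'b"

definition ip_norm :: "('b::cstar_algebra, 'f, 'm) bimodule_scheme \<Rightarrow> 'f \<Rightarrow> real" where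
  "ip_norm F x = sqrt (norm (ip F x x))"

locale hilbert_module = abelian_group F
  for F :: "('b::cstar_algebra, 'f, 'm) bimodule_scheme" (structure) +
  assumes csmult_closed: "x \<in> carrier F \<Longrightarrow> csmult F a x \<in> carrier F"
    and csmult_add_left: "x \<in> carrier F \<Longrightarrow> csmult F (a + a') x = csmult F a x \<oplus> csmult F a' x"
    and csmult_add_right: "\<lbrakk>x \<in> carrier F; y \<in> carrier F\<rbrakk> \<Longrightarrow>
           csmult F a (x \<oplus> y) = csmult F a x \<oplus> csmult F a y"
    and csmult_csmult: "x \<in> carrier F \<Longrightarrow> csmult F a (csmult F a' x) = csmult F (a * a') x"
    and csmult_one: "x \<in> carrier F \<Longrightarrow> csmult F 1 x = x"
    and ract_closed: "x \<in> carrier F \<Longrightarrow> ract F x b \<in> carrier F"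
    and ract_add_left: "\<lbrakk>x \<in> carrier F; y \<in> carrier F\<rbrakk> \<Longrightarrow>
           ract F (x \<oplus> y) b = ract F x b \<oplus> ract F y b"
    and ract_add_right: "x \<in> carrier F \<Longrightarrow> ract F x (b + b') = ract F x b \<oplus> ract F x b'"
    and ract_mult: "x \<in> carrier F \<Longrightarrow> ract F x (b * b') = ract F (ract F x b) b'"
    and ract_one: "x \<in> carrier F \<Longrightarrow> ract F x 1 = x"
    and csmult_ract: "x \<in> carrier F \<Longrightarrow> ract F (csmult F a x) b = csmult F a (ract F x b)"
    and ract_scaleC: "x \<in> carrier F \<Longrightarrow> ract F x (a *\<^sub>C b) = csmult F a (ract F x b)"
    and ip_add: "\<lbrakk>x \<in> carrier F; y \<in> carrier F; z \<in> carrier F\<rbrakk> \<Longrightarrow>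
           ip F x (y \<oplus> z) = ip F x y + ip F x z"
    and ip_csmult: "\<lbrakk>x \<in> carrier F; y \<in> carrier F\<rbrakk> \<Longrightarrow>
           ip F x (csmult F a y) = a *\<^sub>C ip F x y"
    and ip_ract: "\<lbrakk>x \<in> carrier F; y \<in> carrier F\<rbrakk> \<Longrightarrow> ip F x (ract F y b) = ip F x y * b"
    and ip_star: "\<lbrakk>x \<in> carrier F; y \<in> carrier F\<rbrakk> \<Longrightarrow> star (ip F x y) = ip F y x"
    and ip_pos: "x \<in> carrier F \<Longrightarrow> cstar_pos (ip F x x)"
    and ip_definite: "\<lbrakk>x \<in> carrier F; ip F x x = 0\<rbrakk> \<Longrightarrow> x = \<zero>"
    and complete: "\<lbrakk>\<And>n. X n \<in> carrier F;
           \<And>e. e > 0 \<Longrightarrow> \<exists>N. \<forall>m\<ge>N. \<forall>n\<ge>N. ip_norm F (X m \<ominus> X n) < e\<rbrakk> \<Longrightarrow>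
           \<exists>x\<in>carrier F. (\<lambda>n. ip_norm F (X n \<ominus> x)) \<longlonglongrightarrow> 0"

text \<open>\<open>lact_adjoint\<close> says that \<open>b\<close> acts by an adjointable operator with adjoint the action of
  \<open>star b\<close>, so the left action is a *-homomorphism into the adjointable operators. Adjointability
  already forces the action of \<open>b\<close> to be linear over \<open>'b\<close> from the right.\<close>

locale correspondence = hilbert_module F
  for F :: "('b::cstar_algebra, 'f, 'm) bimodule_scheme" (structure) +
  assumes lact_closed: "x \<in> carrier F \<Longrightarrow> lact F b x \<in> carrier F"
    and lact_add_left: "x \<in> carrier F \<Longrightarrow> lact F (b + b') x = lact F b x \<oplus> lact F b' x"
    and lact_scaleC: "x \<in> carrier F \<Longrightarrow> lact F (a *\<^sub>C b) x = csmult F a (lact F b x)"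
    and lact_mult: "x \<in> carrier F \<Longrightarrow> lact F (b * b') x = lact F b (lact F b' x)"
    and lact_one: "x \<in> carrier F \<Longrightarrow> lact F 1 x = x"
    and lact_adjoint: "\<lbrakk>x \<in> carrier F; y \<in> carrier F\<rbrakk> \<Longrightarrow>
           ip F x (lact F b y) = ip F (lact F (star b) x) y"


section \<open>Christensen-Evans generators\<close>

text \<open>HOL cannot quantify existentially over the type of the elements of a correspondence, so that
  type is a parameter: the carrier of \<open>F\<close> ranges over the subsets of \<open>'f\<close>.\<close>

definition has_christensen_evans_generator ::
    "'f itself \<Rightarrow> (real \<Rightarrow> 'b::cstar_algebra \<Rightarrow> 'b) \<Rightarrow> bool" where
  "has_christensen_evans_generator _ T \<longleftrightarrow> uniformly_continuous T \<and>
     (\<exists>(F :: ('b, 'f) bimodule) \<zeta> \<beta>. correspondence F \<and> \<zeta> \<in> carrier F \<and>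
        is_generator (\<lambda>b. ip F \<zeta> (lact F b \<zeta>) + b * \<beta> + star \<beta> * b) T)"

end

(* If T is spatial with unit c, then the maps S t b = T t b - star (c t) * b * c t are completely
   positive, so their norms are controlled by the norm of S t 1, which tends to 0; hence T is
   uniformly continuous. Then T and c are differentiable at 0, and L b - b * beta - star beta * b is the limit
   of S t b / t, a completely positive map, to which the GNS construction applies. Conversely, for
   c t = exp (t * beta), the derivative of s |-> T s (star (c (t - s)) * b * c (t - s)) is
   T s applied to a completely positive function of b, so integrating from 0 to t shows that T dominates
   conjugation by c. *)

theory Submission
  imports Defs
begin

text \<open>The algebra is known only through its axioms, and positivity only as a factorization
  \<open>star x * x\<close>, while the argument passes to sums, limits, integrals and derivatives of
  positive elements. So the factorizable elements must first be shown to form a closed convex cone.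
  A norm inequality describes this cone, and the bridge between the two descriptions is a square
  root given by the binomial series of sqrt(1 - z), whose coefficients are absolutely summable, so
  that it converges on the whole closed unit ball. The root commutes with whatever commutes with the
  element; together with \<open>norm_le_sum_of_squares\<close> this takes the place of functional
  calculus. Matrices are treated by the same series entrywise, once their positivity is restated
  through the quadratic forms \<open>mat_form n A x x\<close>; in that form complete positivity
  survives limits and integration. The Hilbert module is realized inside the functions from the
  algebra to itself, so that neither its completion nor the quotient by null vectors requires a new
  type.\<close>

section \<open>Involution, complex scalars and norm\<close>

lemma star_zero [simp]: "star (0::'b::cstar_algebra) = 0"
  using star_add[of "0::'b" 0] by simp

lemma star_one [simp]: "star (1::'b::cstar_algebra) = 1"
  using star_mult[of "star (1::'b)" 1] by (simp add: star_star)

lemma star_scaleR [simp]: "star (r *\<^sub>R x) = r *\<^sub>R star (x::'b::cstar_algebra)"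
  using star_scaleC[of "complex_of_real r" x] by (simp add: scaleC_of_real)

lemma star_minus [simp]: "star (- x) = - star (x::'b::cstar_algebra)"
  using star_scaleR[of "-1" x] by simp

lemma star_diff: "star (x - y) = star x - star (y::'b::cstar_algebra)"
  using star_add[of x "-y"] by simp

declare star_star [simp]

lemma norm_star [simp]: "norm (star x) = norm (x::'b::cstar_algebra)"
proof -
  have le: "norm y \<le> norm (star y)" for y :: 'b
  proof (cases "y = 0")
    case False
    have "norm y * norm y \<le> norm (star y) * norm y"
      using norm_mult_ineq[of "star y" y] by (simp add: cstar_identity power2_eq_square)
    then show ?thesis using False by simp
  qed simp
  show ?thesis using le[of x] le[of "star x"] by simp
qed

lemma bounded_linear_star: "bounded_linear (star :: 'b::cstar_algebra \<Rightarrow> 'b)"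
  by (rule bounded_linear_intro[where K=1]) (auto simp: star_add)

lemmas star_sum = linear_sum[OF bounded_linear.linear[OF bounded_linear_star]]
lemmas tendsto_star = bounded_linear.tendsto[OF bounded_linear_star]
lemmas continuous_on_star = bounded_linear.continuous_on[OF bounded_linear_star]

lemma star_power: "star (x ^ n) = star (x::'b::cstar_algebra) ^ n"
  by (induction n) (auto simp: star_mult power_commutes)

lemma norm_square_self_adjoint: "star x = x \<Longrightarrow> norm (x * x) = (norm (x::'b::cstar_algebra))\<^sup>2"
  using cstar_identity[of x] by simp

text \<open>The C*-identity squares the norm at each doubling of the exponent; this replaces the
  spectral radius formula.\<close>

lemma norm_power_self_adjoint:
  "star x = x \<Longrightarrow> norm (x ^ 2 ^ k) = norm (x::'b::cstar_algebra) ^ 2 ^ k"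
proof (induction k)
  case (Suc k)
  have "norm (x ^ 2 ^ Suc k) = norm (x ^ 2 ^ k * x ^ 2 ^ k)"
    by (simp add: power_add[symmetric] mult_2)
  also have "\<dots> = (norm (x ^ 2 ^ k))\<^sup>2"
    by (rule norm_square_self_adjoint) (simp add: star_power Suc.prems)
  finally show ?case using Suc by (simp add: power_mult[symmetric] mult.commute)
qed simp

lemma scaleC_zero [simp]: "a *\<^sub>C (0::'b::cstar_algebra) = 0"
  using scaleC_add_right[of a "0::'b" 0] by simp

lemma scaleC_one [simp]: "1 *\<^sub>C (x::'b::cstar_algebra) = x"
  using scaleC_of_real[of 1 x] by simp

lemma scaleC_minus_left: "(- a) *\<^sub>C (x::'b::cstar_algebra) = - (a *\<^sub>C x)"
  using scaleC_scaleC[of "-1" a x] scaleC_of_real[of "-1" "a *\<^sub>C x"] by simp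

lemma scaleC_minus_right: "a *\<^sub>C (- x) = - (a *\<^sub>C (x::'b::cstar_algebra))"
  using scaleC_add_right[of a "x" "-x"] by (simp add: eq_neg_iff_add_eq_0 add.commute)

lemma scaleC_diff_right: "a *\<^sub>C (x - y) = a *\<^sub>C x - a *\<^sub>C (y::'b::cstar_algebra)"
  using scaleC_add_right[of a x "-y"] by (simp add: scaleC_minus_right)

lemma scaleC_scaleR: "a *\<^sub>C (r *\<^sub>R x) = r *\<^sub>R (a *\<^sub>C (x::'b::cstar_algebra))"
  by (simp add: scaleC_of_real[symmetric] scaleC_scaleC mult.commute)

lemma bounded_linear_scaleC: "bounded_linear (\<lambda>x::'b::cstar_algebra. a *\<^sub>C x)"
  by (rule bounded_linear_intro[where K="cmod a"])
     (auto simp: scaleC_add_right scaleC_scaleR norm_scaleC)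

lemma cartesian_decomposition:
  fixes x :: "'b::cstar_algebra"
  obtains h k where "star h = h" "star k = k" "x = h + \<i> *\<^sub>C k" "norm h \<le> norm x" "norm k \<le> norm x"
proof
  let ?h = "(1/2) *\<^sub>R (x + star x)" and ?k = "(1/2) *\<^sub>R ((-\<i>) *\<^sub>C (x - star x))"
  show "star ?h = ?h" by (simp add: star_add add.commute)
  show "star ?k = ?k"
    by (simp add: star_scaleC star_diff scaleC_minus_left scaleC_diff_right)
  show "x = ?h + \<i> *\<^sub>C ?k"
    by (simp add: scaleC_scaleR scaleC_scaleC scaleR_right_distrib[symmetric] scaleR_2[symmetric]
        del: scaleR_right_distrib)
  show "norm ?h \<le> norm x"
    using norm_triangle_ineq[of x "star x"] by simp
  show "norm ?k \<le> norm x"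
    using norm_triangle_ineq4[of x "star x"] by (simp add: norm_scaleC)
qed

text \<open>The right-hand side is \<open>star u * u\<close> for \<open>u = x + \<i> y\<close>, whose real part is \<open>x\<close>.\<close>

lemma norm_le_sum_of_squares:
  fixes x y :: "'b::cstar_algebra"
  assumes x: "star x = x" and y: "star y = y" and xy: "x * y = y * x"
  shows "(norm x)\<^sup>2 \<le> norm (x * x + y * y)"
proof -
  let ?u = "x + \<i> *\<^sub>C y"
  have su: "star ?u = x - \<i> *\<^sub>C y"
    by (simp add: star_add star_scaleC x y scaleC_minus_left)
  have "star ?u * ?u = x * x + y * y"
    unfolding su by (simp add: algebra_simps mult_scaleC_left mult_scaleC_right scaleC_scaleC scaleC_diff_right
        scaleC_add_right xy scaleC_minus_left)
  then have n: "norm (x * x + y * y) = (norm ?u)\<^sup>2" using cstar_identity[of ?u] by simp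
  have "x = (1/2) *\<^sub>R (?u + star ?u)" unfolding su by (simp add: scaleR_2[symmetric])
  from arg_cong[OF this, of norm] have "norm x = (1/2) * norm (?u + star ?u)" unfolding norm_scaleR by simp
  also have "\<dots> \<le> norm ?u" using norm_triangle_ineq[of ?u "star ?u"] by simp
  finally show ?thesis unfolding n by (intro power_mono) auto
qed

section \<open>Square roots\<close>

text \<open>The Taylor coefficients of sqrt(1 - z).\<close>

definition sqrt_coeff :: "nat \<Rightarrow> real" where
  "sqrt_coeff k = pochhammer (- 1 / 2) k / fact k"

lemma sqrt_coeff_gbinomial: "sqrt_coeff k = (-1) ^ k * ((1 / 2) gchoose k)"
  by (simp add: sqrt_coeff_def gbinomial_pochhammer power_mult_distrib[symmetric])

lemma sqrt_coeff_0: "sqrt_coeff 0 = 1" by (simp add: sqrt_coeff_def)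

text \<open>The series squares to 1 - z: Vandermonde's identity for 1/2 + 1/2 turns the convolution
  into the coefficients for the exponent 1.\<close>

lemma sqrt_coeff_convolution:
  "(\<Sum>i\<le>k. sqrt_coeff i * sqrt_coeff (k - i)) = (if k = 0 then 1 else if k = 1 then -1 else 0)"
proof -
  have "(\<Sum>i\<le>k. sqrt_coeff i * sqrt_coeff (k - i))
      = (\<Sum>i\<le>k. (-1) ^ k * (((1/2::real) gchoose i) * ((1/2) gchoose (k - i))))"
    by (intro sum.cong) (auto simp: sqrt_coeff_gbinomial power_add[symmetric])
  also have "\<dots> = (-1) ^ k * ((1::real) gchoose k)"
    using gbinomial_Vandermonde[of "1/2::real" "1/2" k] by (simp add: sum_distrib_left[symmetric] atMost_atLeast0)
  also have "(1::real) gchoose k = of_nat (1 choose k)"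
    by (metis binomial_gbinomial of_nat_1)
  finally show ?thesis by (cases k) (auto simp: binomial_eq_0 split: if_splits)
qed

lemma sqrt_coeff_neg: "k > 0 \<Longrightarrow> sqrt_coeff k \<le> 0"
proof (induction k)
  case (Suc k)
  show ?case
  proof (cases "k = 0")
    case False
    \<comment> \<open>Only the first factor, -1/2, is negative; for positive \<open>k\<close> the
      new factor preserves the sign.\<close>
    have "pochhammer (- 1 / 2 :: real) (Suc k) = pochhammer (- 1/2) k * (-1/2 + real k)"
      by (rule pochhammer_Suc)
    moreover have "pochhammer (- 1/2 :: real) k \<le> 0"
      using Suc False mult_nonpos_nonneg[of "sqrt_coeff k" "fact k"] by (simp add: sqrt_coeff_def)
    moreover have "-1/2 + real k \<ge> 0" using False by (cases k) auto
    ultimately have "pochhammer (- 1 / 2 :: real) (Suc k) \<le> 0"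
      by (simp add: mult_nonpos_nonneg)
    then show ?thesis by (simp add: sqrt_coeff_def divide_le_0_iff del: fact_Suc)
  qed (simp add: sqrt_coeff_def)
qed simp

text \<open>At z = 1 the partial sums have a closed form, by the formula for alternating sums of
  binomial coefficients.\<close>

lemma sum_sqrt_coeff_nonneg: "(\<Sum>k\<le>n. sqrt_coeff k) \<ge> 0"
proof -
  have "(\<Sum>k\<le>n. sqrt_coeff k) = (\<Sum>k\<le>n. ((1/2::real) gchoose k) * (-1) ^ k)"
    by (simp add: sqrt_coeff_gbinomial mult.commute)
  also have "\<dots> = (-1) ^ n * ((-1/2::real) gchoose n)"
    by (simp add: gbinomial_sum_lower_neg)
  also have "\<dots> = pochhammer (1/2::real) n / fact n"
    by (simp add: gbinomial_pochhammer power_mult_distrib[symmetric])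
  finally show ?thesis using pochhammer_nonneg[of "1/2::real" n] by simp
qed

text \<open>After the leading 1 all coefficients are nonpositive, so a sum of their absolute values
  is 1 minus a partial sum of the series, and partial sums are nonnegative. The bound 1 is what
  later places the root within distance 1 of the unit.\<close>

lemma sqrt_coeff_Suc_bounds:
  "summable (\<lambda>k. \<bar>sqrt_coeff (Suc k)\<bar>)" "(\<Sum>k. \<bar>sqrt_coeff (Suc k)\<bar>) \<le> 1"
proof -
  have b: "(\<Sum>k<n. \<bar>sqrt_coeff (Suc k)\<bar>) \<le> 1" for n
  proof -
    have "(\<Sum>k<n. \<bar>sqrt_coeff (Suc k)\<bar>) = - (\<Sum>k<n. sqrt_coeff (Suc k))"
      by (simp add: sum_negf[symmetric] abs_of_nonpos sqrt_coeff_neg)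
    moreover have "(\<Sum>k\<le>n. sqrt_coeff k) = 1 + (\<Sum>k<n. sqrt_coeff (Suc k))"
      by (subst sum.atMost_shift) (simp add: sqrt_coeff_0)
    ultimately show ?thesis using sum_sqrt_coeff_nonneg[of n] by simp
  qed
  show s: "summable (\<lambda>k. \<bar>sqrt_coeff (Suc k)\<bar>)"
    by (rule summableI_nonneg_bounded[OF _ b]) auto
  show "(\<Sum>k. \<bar>sqrt_coeff (Suc k)\<bar>) \<le> 1"
    by (rule suminf_le_const[OF s b])
qed

lemma summable_abs_sqrt_coeff: "summable (\<lambda>k. \<bar>sqrt_coeff k\<bar>)"
  using sqrt_coeff_Suc_bounds(1) by (subst (asm) summable_Suc_iff)

text \<open>The bound on \<open>1 - y\<close> makes the root itself positive, and the commutation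
  property holds because \<open>y\<close> is a limit of polynomials in \<open>z\<close>.\<close>

lemma sqrt_one_minus:
  fixes z :: "'b::cstar_algebra"
  assumes z: "star z = z" "norm z \<le> 1"
  obtains y where "star y = y" "y * y = 1 - z" "norm (1 - y) \<le> 1"
    "\<And>x. x * z = z * x \<Longrightarrow> x * y = y * x"
proof -
  let ?f = "\<lambda>k. sqrt_coeff k *\<^sub>R z ^ k"
  have zk: "norm (z ^ k) \<le> 1" for k
    using norm_power_ineq[of z k] power_le_one[of "norm z" k] z(2) by auto
  have nf: "norm (?f k) \<le> \<bar>sqrt_coeff k\<bar>" for k
    using mult_left_mono[OF zk, of "\<bar>sqrt_coeff k\<bar>" k] by simp
  have sn: "summable (\<lambda>k. norm (?f k))"
    by (rule summable_comparison_test'[OF summable_abs_sqrt_coeff, of 0]) (use nf in auto)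
  have sf: "summable ?f" by (rule summable_norm_cancel[OF sn])
  let ?y = "\<Sum>k. ?f k"
  show thesis
  proof
    show "star ?y = ?y"
      using bounded_linear.suminf[OF bounded_linear_star sf] by (simp add: star_power z(1))
    have "?y * ?y = (\<Sum>k. \<Sum>i\<le>k. ?f i * ?f (k - i))"
      by (rule Cauchy_product[OF sn sn])
    also have "(\<lambda>k. \<Sum>i\<le>k. ?f i * ?f (k - i)) = (\<lambda>k. (\<Sum>i\<le>k. sqrt_coeff i * sqrt_coeff (k - i)) *\<^sub>R z ^ k)"
      by (auto simp: scaleR_sum_left power_add[symmetric] intro!: sum.cong)
    also have "\<dots> = (\<lambda>k. if k \<in> {0,1} then (if k = 0 then 1 else - z) else 0)"
      by (auto simp: sqrt_coeff_convolution)
    also have "suminf \<dots> = (\<Sum>k\<in>{0,1::nat}. if k = 0 then 1 else - z)"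
      by (subst suminf_finite[of "{0,1}"]) auto
    finally show "?y * ?y = 1 - z" by simp
    have sS: "summable (\<lambda>k. norm (?f (Suc k)))"
      using sn summable_Suc_iff[of "\<lambda>k. norm (?f k)"] by blast
    have "1 - ?y = - (\<Sum>k. ?f (Suc k))"
      using suminf_split_head[OF sf] by (simp add: sqrt_coeff_0)
    then have "norm (1 - ?y) = norm (\<Sum>k. ?f (Suc k))" by (metis norm_minus_cancel)
    also have "\<dots> \<le> (\<Sum>k. norm (?f (Suc k)))" by (rule summable_norm[OF sS])
    also have "\<dots> \<le> (\<Sum>k. \<bar>sqrt_coeff (Suc k)\<bar>)"
      by (rule suminf_le[OF nf sS sqrt_coeff_Suc_bounds(1)])
    also have "\<dots> \<le> 1" by (rule sqrt_coeff_Suc_bounds(2))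
    finally show "norm (1 - ?y) \<le> 1" .
    show "x * ?y = ?y * x" if "x * z = z * x" for x
    proof -
      have "x * z ^ k = z ^ k * x" for k using power_commuting_commutes[OF that[symmetric]] by simp
      then have "(\<lambda>k. x * ?f k) = (\<lambda>k. ?f k * x)" by auto
      then show ?thesis using suminf_mult[OF sf, of x] suminf_mult2[OF sf, of x] by simp
    qed
  qed
qed

section \<open>The positive cone\<close>

text \<open>Unlike \<^const>\<open>cstar_pos\<close>, this characterization of positivity is visibly closed and convex.\<close>

definition norm_pos :: "'b::cstar_algebra \<Rightarrow> bool" where
  "norm_pos a \<longleftrightarrow> star a = a \<and> norm (norm a *\<^sub>R 1 - a) \<le> norm a"

text \<open>Rescaling by \<open>r\<close> reduces the claim to the root of \<open>1 - z\<close> with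
  \<open>z = 1 - (1 / r) a\<close>; radius \<open>0\<close> forces \<open>a = 0\<close>.\<close>

lemma sqrt_within_radius:
  fixes a :: "'b::cstar_algebra"
  assumes a: "star a = a" and r: "norm (r *\<^sub>R 1 - a) \<le> r"
  obtains y where "star y = y" "y * y = a" "norm (sqrt r *\<^sub>R 1 - y) \<le> sqrt r"
    "\<And>x. x * a = a * x \<Longrightarrow> x * y = y * x"
proof (cases "r = 0")
  case True
  then show ?thesis using r that[of 0] by simp
next
  case False
  have r0: "r > 0" using r False norm_ge_zero[of "r *\<^sub>R 1 - a"] by linarith
  let ?z = "1 - (1 / r) *\<^sub>R a"
  have "?z = (1/r) *\<^sub>R (r *\<^sub>R 1 - a)" using r0 by (simp add: algebra_simps)
  then have "norm ?z = (1/r) * norm (r *\<^sub>R 1 - a)" using r0 norm_scaleR[of "1/r" "r *\<^sub>R 1 - a"] by simp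
  then have nz: "norm ?z \<le> 1" using r r0 by simp
  have sz: "star ?z = ?z" using a by (simp add: star_diff)
  obtain y where y: "star y = y" "y * y = 1 - ?z" "norm (1 - y) \<le> 1"
    and c: "\<And>x. x * ?z = ?z * x \<Longrightarrow> x * y = y * x"
    by (rule sqrt_one_minus[OF sz nz]) blast
  let ?w = "sqrt r *\<^sub>R y"
  show ?thesis
  proof (rule that[of ?w])
    show "star ?w = ?w" using y by simp
    show "?w * ?w = a" using y(2) r0 by simp
    have "sqrt r *\<^sub>R 1 - ?w = sqrt r *\<^sub>R (1 - y)" by (simp add: algebra_simps)
    then show "norm (sqrt r *\<^sub>R 1 - ?w) \<le> sqrt r" using y(3) r0 by (simp add: mult_left_le)
    show "x * ?w = ?w * x" if "x * a = a * x" for x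
      using c[of x] that by (simp add: algebra_simps)
  qed
qed

text \<open>The element \<open>r 1 - a * a\<close> lies within \<open>r\<close> of
  \<open>r 1\<close>, so it has a root \<open>s\<close>. As \<open>s\<close> commutes with
  \<open>a\<close> and \<open>s * s + a * a = r 1\<close>, the norm of \<open>s * s\<close> is at
  most \<open>r\<close>.\<close>

lemma norm_diff_square_le:
  fixes a :: "'b::cstar_algebra"
  assumes a: "star a = a" and r: "norm (a * a) \<le> r"
  shows "norm (r *\<^sub>R 1 - a * a) \<le> r"
proof -
  have n: "norm (r *\<^sub>R 1 - (r *\<^sub>R 1 - a * a)) \<le> r" using r by simp
  have s: "star (r *\<^sub>R 1 - a * a) = r *\<^sub>R 1 - a * a" using a by (simp add: star_diff star_mult)
  obtain s where s: "star s = s" "s * s = r *\<^sub>R 1 - a * a"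
    and c: "\<And>x. x * (r *\<^sub>R 1 - a * a) = (r *\<^sub>R 1 - a * a) * x \<Longrightarrow> x * s = s * x"
    by (rule sqrt_within_radius[OF s n]) blast
  have "a * s = s * a" by (rule c) (simp add: algebra_simps)
  then have "(norm s)\<^sup>2 \<le> norm (s * s + a * a)" by (intro norm_le_sum_of_squares s a) simp
  then show ?thesis using s norm_square_self_adjoint[OF s(1)] norm_ge_zero[of "a * a"] r
    by (simp add: abs_of_nonneg[OF order.trans[OF norm_ge_zero r]])
qed

lemma norm_pos_square: "star a = a \<Longrightarrow> norm_pos (a * a)"
  by (simp add: norm_pos_def star_mult norm_diff_square_le)

text \<open>The radius in \<open>norm_pos\<close> may be arbitrary: the ball condition at any radius
  yields a self-adjoint root, and a square satisfies the condition at the radius given by its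
  norm.\<close>

lemma norm_posI:
  assumes "star a = a" "norm (r *\<^sub>R 1 - a) \<le> r"
  shows "norm_pos a"
proof -
  obtain y where y: "star y = y" "y * y = a" using assms by (rule sqrt_within_radius) blast
  show ?thesis using norm_pos_square[OF y(1)] unfolding y(2) .
qed

lemma norm_posE:
  assumes "norm_pos a"
  obtains y where "star y = y" "y * y = a" "norm_pos y" "\<And>x. x * a = a * x \<Longrightarrow> x * y = y * x"
proof -
  have "star a = a" "norm (norm a *\<^sub>R 1 - a) \<le> norm a" using assms by (auto simp: norm_pos_def)
  then obtain y where y: "star y = y" "y * y = a" "norm (sqrt (norm a) *\<^sub>R 1 - y) \<le> sqrt (norm a)"
    "\<And>x. x * a = a * x \<Longrightarrow> x * y = y * x"
    by (rule sqrt_within_radius) blast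
  show ?thesis by (rule that[OF y(1,2) norm_posI[OF y(1,3)] y(4)])
qed

lemma norm_pos_radius:
  assumes "norm_pos a" "norm a \<le> r" shows "norm (r *\<^sub>R 1 - a) \<le> r"
proof -
  obtain y where y: "star y = y" "y * y = a" using assms(1) by (rule norm_posE) blast
  show ?thesis using norm_diff_square_le[OF y(1), of r] assms(2) unfolding y(2) .
qed

lemma norm_pos_zero [simp]: "norm_pos 0" by (simp add: norm_pos_def)

lemma norm_pos_scaleR:
  assumes "norm_pos a" "r \<ge> 0" shows "norm_pos (r *\<^sub>R a)"
proof (rule norm_posI[of _ "r * norm a"])
  show "star (r *\<^sub>R a) = r *\<^sub>R a" using assms by (simp add: norm_pos_def)
  have "(r * norm a) *\<^sub>R 1 - r *\<^sub>R a = r *\<^sub>R (norm a *\<^sub>R 1 - a)" by (simp add: algebra_simps)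
  then show "norm ((r * norm a) *\<^sub>R 1 - r *\<^sub>R a) \<le> r * norm a"
    using assms by (simp add: norm_pos_def mult_left_mono)
qed

text \<open>Radii add by the triangle inequality; that \<open>norm a + norm b\<close> may exceed
  \<open>norm (a + b)\<close> is harmless by \<open>norm_posI\<close>.\<close>

lemma norm_pos_add:
  assumes "norm_pos a" "norm_pos b" shows "norm_pos (a + b)"
proof (rule norm_posI[of _ "norm a + norm b"])
  show "star (a + b) = a + b" using assms by (simp add: norm_pos_def star_add)
  have "(norm a + norm b) *\<^sub>R 1 - (a + b) = (norm a *\<^sub>R 1 - a) + (norm b *\<^sub>R 1 - b)"
    by (simp add: algebra_simps)
  then show "norm ((norm a + norm b) *\<^sub>R 1 - (a + b)) \<le> norm a + norm b"
    unfolding \<open>(norm a + norm b) *\<^sub>R 1 - (a + b) = _\<close>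
    using assms norm_triangle_ineq[of "norm a *\<^sub>R 1 - a" "norm b *\<^sub>R 1 - b"]
    by (simp add: norm_pos_def)
qed

lemma norm_pos_closed: "closed {a::'b::cstar_algebra. norm_pos a}"
proof -
  have "closed {a::'b. star a = a}"
    by (intro closed_Collect_eq continuous_on_star continuous_on_id)
  moreover have "closed {a::'b. norm (norm a *\<^sub>R 1 - a) \<le> norm a}"
    by (intro closed_Collect_le continuous_intros)
  ultimately show ?thesis unfolding norm_pos_def by (rule closed_Collect_conj)
qed

text \<open>The roots \<open>y\<close> of \<open>a\<close> and \<open>z\<close> of
  \<open>- a\<close> commute, and their squares add up to 0.\<close>

lemma norm_pos_antisym:
  fixes a :: "'b::cstar_algebra"
  assumes "norm_pos a" "norm_pos (- a)" shows "a = 0"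
proof -
  obtain y where y: "star y = y" "y * y = a" and cy: "\<And>x. x * a = a * x \<Longrightarrow> x * y = y * x"
    using assms(1) by (rule norm_posE) blast
  obtain z where z: "star z = z" "z * z = - a" and cz: "\<And>x. x * (- a) = (- a) * x \<Longrightarrow> x * z = z * x"
    using assms(2) by (rule norm_posE) blast
  have "y * a = a * y" unfolding y(2)[symmetric] by (simp add: mult.assoc)
  then have "y * z = z * y" by (intro cz) simp
  from norm_le_sum_of_squares[OF y(1) z(1) this] y(2) z(2) have "y = 0" by simp
  then show ?thesis using y by simp
qed

text \<open>Exponents are restricted to powers of two because these are the ones at which
  \<open>norm_power_self_adjoint\<close> evaluates the norm.\<close>

lemma exponential_beats_linear:
  fixes q :: real
  assumes "\<And>k. q ^ 2 ^ k \<le> 1 + 2 ^ k" shows "q \<le> 1"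
proof (rule ccontr)
  assume "\<not> q \<le> 1"
  then have q: "norm (inverse q) < 1" "q > 1" by (auto simp: field_simps)
  have "(\<lambda>n. of_nat n * inverse q ^ n) \<longlonglongrightarrow> (0::real)" by (rule powser_times_n_limit_0[OF q(1)])
  moreover have "(\<lambda>n. inverse q ^ n) \<longlonglongrightarrow> 0" using q by (intro LIMSEQ_power_zero) auto
  ultimately have "(\<lambda>n. inverse q ^ n + of_nat n * inverse q ^ n) \<longlonglongrightarrow> 0 + 0" by (intro tendsto_add)
  then have "(\<lambda>n. (1 + real n) * inverse q ^ n) \<longlonglongrightarrow> 0" by (simp add: algebra_simps)
  then obtain N where N: "\<And>n. n \<ge> N \<Longrightarrow> \<bar>(1 + real n) * inverse q ^ n\<bar> < 1"
    using LIMSEQ_D[of _ 0 1] by fastforce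
  have "(1 + real (2^N)) * inverse q ^ 2^N < 1" using N[of "2^N"] by (simp add: less_imp_le)
  then have "1 + real (2^N) < q ^ 2^N" using q by (simp add: field_simps)
  with assms[of N] show False by simp
qed

text \<open>Since \<open>(1 - star z * z) ^ N = 1 - star z * (\<Sum>k<N. (1 - z * star z) ^ k) * z\<close>, the powers of
  the self-adjoint element \<open>1 - star z * z\<close> grow at most linearly, so its norm is at most \<open>1\<close>.\<close>

lemma norm_pos_star_swap:
  fixes z :: "'b::cstar_algebra"
  assumes "norm_pos (z * star z)" shows "norm_pos (star z * z)"
proof -
  \<comment> \<open>For a contraction, \<open>norm ?d \<le> 1\<close>, which keeps the sum of
    \<open>N\<close> powers of \<open>?d\<close> below \<open>N\<close>. The general case is
    rescaled to this one.\<close>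
  have small: "norm_pos (star z * z)" if p: "norm_pos (z * star z)" and nz: "norm z \<le> 1" for z :: 'b
  proof -
    let ?d = "1 - z * star z" and ?e = "1 - star z * z"
    have pw: "?e ^ N = 1 - star z * (\<Sum>k<N. ?d ^ k) * z" for N
    proof (induction N)
      case (Suc N)
      have c: "?d ^ k * z = z * ?e ^ k" for k
        by (induction k) (auto simp: algebra_simps)
      have "?e ^ Suc N = ?e ^ N - star z * (z * ?e ^ N)" by (simp add: algebra_simps)
      also have "\<dots> = ?e ^ N - star z * ?d ^ N * z" by (simp add: c mult.assoc)
      finally show ?case unfolding Suc.IH sum.lessThan_Suc
        by (simp only: distrib_left distrib_right diff_diff_add)
    qed simp
    have "norm (z * star z) \<le> 1"
      using norm_mult_ineq[of z "star z"] nz mult_mono[OF nz nz] by simp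
    from norm_pos_radius[OF p this] have d: "norm ?d \<le> 1" by simp
    have nd: "norm (?d ^ k) \<le> 1" for k
      using norm_power_ineq[of ?d k] power_le_one[of "norm ?d" k] d by auto
    have bound: "norm (?e ^ N) \<le> 1 + real N" for N
    proof -
      have "norm (\<Sum>k<N. ?d ^ k) \<le> real N"
        using sum_norm_le[of "{..<N}" "\<lambda>k. ?d ^ k" "\<lambda>_. 1"] nd by simp
      then have "norm (star z * (\<Sum>k<N. ?d ^ k) * z) \<le> 1 * real N * 1"
        by (intro order.trans[OF norm_mult_ineq] mult_mono) (use nz in auto)
      then show ?thesis unfolding pw
        using norm_triangle_ineq4[of 1 "star z * (\<Sum>k<N. ?d ^ k) * z"] by simp
    qed
    have e: "star ?e = ?e" by (simp add: star_diff star_mult)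
    have "norm ?e \<le> 1"
      by (rule exponential_beats_linear) (use bound norm_power_self_adjoint[OF e] in \<open>metis of_nat_numeral of_nat_power\<close>)
    then show ?thesis by (intro norm_posI[of _ 1]) (auto simp: star_mult)
  qed
  show ?thesis
  proof (cases "z = 0")
    case False
    let ?r = "inverse (norm z)"
    have "norm_pos ((?r *\<^sub>R z) * star (?r *\<^sub>R z))"
      using norm_pos_scaleR[OF assms, of "?r * ?r"] by simp
    from small[OF this] have "norm_pos (star (?r *\<^sub>R z) * (?r *\<^sub>R z))" using False by simp
    from norm_pos_scaleR[OF this, of "norm z * norm z"]
    have "norm_pos (((norm z * ?r) * (norm z * ?r)) *\<^sub>R (star z * z))" by (simp add: mult.left_commute mult.assoc)
    then show ?thesis using False by simp
  qed simp
qed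

text \<open>In \<open>star z * z + z * star z\<close> the mixed terms of the cartesian decomposition
  cancel, leaving a sum of squares. Hence \<open>z * star z\<close> is positive, then
  \<open>star z * z\<close> by swapping, and antisymmetry applies.\<close>

lemma star_mult_self_neg_imp_zero:
  fixes z :: "'b::cstar_algebra"
  assumes "norm_pos (- (star z * z))" shows "z = 0"
proof -
  obtain h k where hk: "star h = h" "star k = k" "z = h + \<i> *\<^sub>C k"
    by (rule cartesian_decomposition[of z]) blast
  have sz: "star z = h - \<i> *\<^sub>C k" using hk by (simp add: star_add star_scaleC scaleC_minus_left)
  have "star z * z + z * star z = 2 *\<^sub>R (h * h + k * k)"
    unfolding sz unfolding hk(3)
    by (simp add: algebra_simps mult_scaleC_left mult_scaleC_right scaleC_scaleC scaleC_minus_left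
        scaleC_diff_right scaleC_add_right scaleR_2)
  then have "z * star z = 2 *\<^sub>R (h * h + k * k) + - (star z * z)" by (simp add: algebra_simps)
  also have "norm_pos \<dots>"
    by (intro norm_pos_add norm_pos_scaleR norm_pos_square hk assms) simp
  finally have "norm_pos (star z * z)" by (rule norm_pos_star_swap)
  from norm_pos_antisym[OF this assms] show ?thesis using cstar_identity[of z] by simp
qed

text \<open>With \<open>n = \<bar>a\<bar> - a\<close> for \<open>a = star x * x\<close>, one has \<open>n * n = 2 \<bar>a\<bar> n\<close> and hence
  \<open>star (x n) * (x n) = n a n = - \<bar>a\<bar> n\<^sup>2 \<le> 0\<close>; so \<open>n = 0\<close>.\<close>

lemma norm_pos_star_mult_self: "norm_pos (star x * (x::'b::cstar_algebra))"
proof -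
  let ?a = "star x * x"
  have a: "star ?a = ?a" by (simp add: star_mult)
  obtain b where b: "star b = b" "b * b = ?a * ?a" "norm_pos b"
    and cb: "\<And>x. x * (?a * ?a) = (?a * ?a) * x \<Longrightarrow> x * b = b * x"
    using norm_pos_square[OF a] by (rule norm_posE) blast
  have ab: "?a * b = b * ?a" by (rule cb) (simp add: mult.assoc)
  \<comment> \<open>The root \<open>m\<close> of \<open>b\<close> commutes with \<open>?n\<close>,
    so \<open>b * ?n * ?n\<close> becomes the square of the self-adjoint element
    \<open>m * ?n\<close>.\<close>
  obtain m where m: "star m = m" "m * m = b" and cm: "\<And>x. x * b = b * x \<Longrightarrow> x * m = m * x"
    using b(3) by (rule norm_posE) blast
  let ?n = "b - ?a"
  have n: "star ?n = ?n" using a b by (simp add: star_diff)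
  have nm: "?n * m = m * ?n" by (rule cm) (use ab in \<open>simp add: algebra_simps\<close>)
  have nn: "?n * ?n = 2 *\<^sub>R (b * ?n)" using ab b(2) by (simp add: algebra_simps scaleR_2)
  have na: "?n * ?a = - (b * ?n)" using ab b(2) by (simp add: algebra_simps)
  have bn: "b * ?n = ?n * b" using ab by (simp add: algebra_simps)
  have "star (x * ?n) * (x * ?n) = ?n * ?a * ?n" using n by (simp add: star_mult mult.assoc)
  also have "\<dots> = - (b * ?n * ?n)" unfolding na by simp
  also have "b * ?n * ?n = m * (m * ?n) * ?n" unfolding m(2)[symmetric] by (simp only: mult.assoc)
  also have "\<dots> = m * (?n * m) * ?n" by (simp only: nm)
  also have "\<dots> = (m * ?n) * (m * ?n)" by (simp only: mult.assoc)
  finally have e: "star (x * ?n) * (x * ?n) = - ((m * ?n) * (m * ?n))" .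
  have mn: "star (m * ?n) = m * ?n" using n m(1) nm by (simp add: star_mult)
  have "x * ?n = 0"
    by (rule star_mult_self_neg_imp_zero) (use e norm_pos_square[OF mn] in simp)
  with e have "(m * ?n) * (m * ?n) = 0" by simp
  then have "m * ?n = 0" using norm_square_self_adjoint[OF mn] by simp
  then have "b * ?n = 0" unfolding m(2)[symmetric] by (simp add: mult.assoc)
  then have "?n = 0" using nn norm_square_self_adjoint[OF n] by simp
  then show ?thesis using b(3) by simp
qed

lemma cstar_pos_iff: "cstar_pos a \<longleftrightarrow> norm_pos a"
proof
  show "norm_pos a" if "cstar_pos a" using that norm_pos_star_mult_self by (auto simp: cstar_pos_def)
  show "cstar_pos a" if "norm_pos a"
  proof -
    obtain y where y: "star y = y" "y * y = a" using \<open>norm_pos a\<close> by (rule norm_posE) blast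
    show ?thesis unfolding cstar_pos_def by (rule exI[of _ y]) (simp add: y)
  qed
qed

section \<open>Order and norm\<close>

lemma cstar_pos_self_adjoint: "cstar_pos a \<Longrightarrow> star a = a"
  by (simp add: cstar_pos_iff norm_pos_def)

lemma cstar_pos_star_mult: "cstar_pos (star x * x)"
  by (auto simp: cstar_pos_def)

lemma cstar_pos_zero [simp]: "cstar_pos 0" by (simp add: cstar_pos_iff)

lemma cstar_pos_add: "cstar_pos a \<Longrightarrow> cstar_pos b \<Longrightarrow> cstar_pos (a + b)"
  by (simp add: cstar_pos_iff norm_pos_add)

lemma cstar_pos_scaleR: "cstar_pos a \<Longrightarrow> r \<ge> 0 \<Longrightarrow> cstar_pos (r *\<^sub>R a)"
  by (simp add: cstar_pos_iff norm_pos_scaleR)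

lemma cstar_pos_sum: "(\<And>i. i \<in> I \<Longrightarrow> cstar_pos (f i)) \<Longrightarrow> cstar_pos (sum f I)"
  by (induction I rule: infinite_finite_induct) (auto intro: cstar_pos_add)

lemma cstar_pos_closed: "closed {a::'b::cstar_algebra. cstar_pos a}"
  using norm_pos_closed by (simp add: cstar_pos_iff)

lemma cstar_pos_limit:
  assumes "(f \<longlongrightarrow> l) G" "eventually (\<lambda>x. cstar_pos (f x)) G" "G \<noteq> bot"
  shows "cstar_pos l"
  using Lim_in_closed_set[OF cstar_pos_closed, of f G l] assms by simp

lemma cstar_pos_conj:
  assumes "cstar_pos a" shows "cstar_pos (star b * a * b)"
proof -
  obtain x where "a = star x * x" using assms by (auto simp: cstar_pos_def)
  then have "star b * a * b = star (x * b) * (x * b)" by (simp add: star_mult mult.assoc)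
  then show ?thesis by (simp add: cstar_pos_star_mult)
qed

lemma cstar_pos_norm_diff:
  assumes "star a = a" "norm a \<le> r" shows "cstar_pos (r *\<^sub>R 1 - a)"
  unfolding cstar_pos_iff by (rule norm_posI[of _ r]) (use assms in \<open>auto simp: star_diff\<close>)

text \<open>The roots \<open>y\<close> of \<open>r 1 - b\<close> and \<open>z\<close> of
  \<open>r 1 + b\<close> commute with each other and with \<open>b\<close>, so the square of
  \<open>y * z\<close> is \<open>r * r - b * b\<close>. Thus \<open>b * b\<close> plus a square
  equals \<open>r * r\<close>.\<close>

lemma norm_le_of_order_bounds:
  fixes b :: "'b::cstar_algebra"
  assumes p: "cstar_pos (r *\<^sub>R 1 - b)" "cstar_pos (r *\<^sub>R 1 + b)" and r: "r \<ge> 0"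
  shows "norm b \<le> r"
proof -
  obtain y where y: "star y = y" "y * y = r *\<^sub>R 1 - b"
    and cy: "\<And>x. x * (r *\<^sub>R 1 - b) = (r *\<^sub>R 1 - b) * x \<Longrightarrow> x * y = y * x"
    using p(1) unfolding cstar_pos_iff by (rule norm_posE) blast
  obtain z where z: "star z = z" "z * z = r *\<^sub>R 1 + b"
    and cz: "\<And>x. x * (r *\<^sub>R 1 + b) = (r *\<^sub>R 1 + b) * x \<Longrightarrow> x * z = z * x"
    using p(2) unfolding cstar_pos_iff by (rule norm_posE) blast
  have by': "b * y = y * b" by (rule cy) (simp add: algebra_simps)
  have bz: "b * z = z * b" by (rule cz) (simp add: algebra_simps)
  have yz: "y * z = z * y" by (rule cz) (simp add: algebra_simps by')
  have b: "star b = b" using cstar_pos_self_adjoint[OF p(2)] by (simp add: star_add)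
  have "(y * z) * (y * z) = y * (z * y) * z" by (simp only: mult.assoc)
  also have "\<dots> = (y * y) * (z * z)" unfolding yz[symmetric] by (simp only: mult.assoc)
  also have "\<dots> = (r * r) *\<^sub>R 1 - b * b" unfolding y z by (simp add: algebra_simps)
  finally have e: "b * b + (y * z) * (y * z) = (r * r) *\<^sub>R 1" by simp
  have "b * (y * z) = y * z * b" using by' bz by (metis mult.assoc)
  then have "(norm b)\<^sup>2 \<le> norm (b * b + (y * z) * (y * z))"
    by (intro norm_le_sum_of_squares) (simp_all add: b star_mult y z yz)
  then have "(norm b)\<^sup>2 \<le> r\<^sup>2" unfolding e using r by (simp add: power2_eq_square)
  then show ?thesis using r by (simp add: power2_le_iff_abs_le)
qed

lemma norm_mono_cstar_pos:
  fixes a b :: "'b::cstar_algebra"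
  assumes "cstar_pos a" "cstar_pos (b - a)" shows "norm a \<le> norm b"
proof (rule norm_le_of_order_bounds)
  have "star b = b" using cstar_pos_self_adjoint[OF cstar_pos_add[OF assms]] by simp
  then have "cstar_pos ((norm b *\<^sub>R 1 - b) + (b - a))"
    by (intro cstar_pos_add assms cstar_pos_norm_diff) auto
  then show "cstar_pos (norm b *\<^sub>R 1 - a)" by simp
  have "cstar_pos (norm b *\<^sub>R star 1 * 1)" 
    by (metis cstar_pos_scaleR cstar_pos_star_mult norm_ge_zero mult_scaleR_left)
  then show "cstar_pos (norm b *\<^sub>R 1 + a)" using assms(1) by (auto intro: cstar_pos_add)
qed simp

section \<open>Positive matrices\<close>

text \<open>Evaluating the positive form at \<open>(- r G, 1)\<close> gives \<open>(2 r - r\<^sup>2 \<parallel>A\<parallel>) G\<^sup>* G \<le> D\<close>.\<close>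

lemma cstar_cauchy_schwarz:
  fixes A D G :: "'b::cstar_algebra"
  assumes pos: "\<And>b d. cstar_pos (star b * A * b + star b * G * d + star d * star G * b + star d * D * d)"
  shows "(norm G)\<^sup>2 \<le> norm A * norm D"
proof -
  have A: "cstar_pos A" using pos[of 1 0] by simp
  have key: "(2 * r - r\<^sup>2 * norm A) * (norm G)\<^sup>2 \<le> norm D" if r: "2 * r - r\<^sup>2 * norm A \<ge> 0" for r
  proof -
    let ?w = "2 * r - r\<^sup>2 * norm A" and ?P = "star G * G"
    \<comment> \<open>Adding this term replaces \<open>A\<close> by its norm in the quadratic
      part.\<close>
    have "cstar_pos (r\<^sup>2 *\<^sub>R (star G * (norm A *\<^sub>R 1 - A) * G))"
      by (intro cstar_pos_scaleR cstar_pos_conj cstar_pos_norm_diff cstar_pos_self_adjoint A) auto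
    from cstar_pos_add[OF pos[of "- r *\<^sub>R G" 1] this]
    have "cstar_pos (D - ?w *\<^sub>R ?P)"
      by (simp add: algebra_simps power2_eq_square scaleR_2[symmetric] flip: scaleR_add_left)
    then have "norm (?w *\<^sub>R ?P) \<le> norm D"
      by (intro norm_mono_cstar_pos cstar_pos_scaleR r cstar_pos_star_mult) auto
    then show ?thesis using r by (simp add: cstar_identity)
  qed
  show ?thesis
  proof (cases "norm A = 0")
    case False
    \<comment> \<open>This \<open>r\<close> maximizes the coefficient on the left of
      \<open>key\<close>.\<close>
    then have "(inverse (norm A))\<^sup>2 * norm A = inverse (norm A)" by (simp add: power2_eq_square)
    then have "(inverse (norm A)) * (norm G)\<^sup>2 \<le> norm D"
      using key[of "inverse (norm A)"] by simp
    then show ?thesis using False by (simp add: field_simps)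
  next
    case True
    have "(norm G)\<^sup>2 = 0"
    proof (rule ccontr)
      assume g: "(norm G)\<^sup>2 \<noteq> 0"
      \<comment> \<open>With \<open>norm A = 0\<close>, \<open>key\<close> holds for every
        nonnegative \<open>r\<close>; this one makes its left side
        \<open>2 * (norm D + 1)\<close>.\<close>
      have "2 * ((norm D + 1) / (norm G)\<^sup>2) * (norm G)\<^sup>2 \<le> norm D"
        using key[of "(norm D + 1) / (norm G)\<^sup>2"] True by simp
      with g show False by (simp add: add_nonneg_pos) (smt (verit) norm_ge_zero)
    qed
    then show ?thesis using True by simp
  qed
qed

definition mat_form :: "nat \<Rightarrow> (nat \<Rightarrow> nat \<Rightarrow> 'b::cstar_algebra) \<Rightarrow> (nat \<Rightarrow> 'b) \<Rightarrow> (nat \<Rightarrow> 'b) \<Rightarrow> 'b" where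
  "mat_form n A x y = (\<Sum>i<n. \<Sum>j<n. star (x i) * A i j * y j)"

text \<open>This version of positivity visibly passes to sums and limits of matrices;
  \<open>matrix_pos_iff_form_pos\<close> identifies it with factorizability.\<close>

definition form_pos :: "nat \<Rightarrow> (nat \<Rightarrow> nat \<Rightarrow> 'b::cstar_algebra) \<Rightarrow> bool" where
  "form_pos n A \<longleftrightarrow> (\<forall>x. cstar_pos (mat_form n A x x))"

lemma form_posD: "form_pos n A \<Longrightarrow> cstar_pos (mat_form n A x x)"
  by (simp add: form_pos_def)

lemma mat_form_add_left: "mat_form n A (\<lambda>i. x i + x' i) y = mat_form n A x y + mat_form n A x' y"
  by (simp add: mat_form_def star_add distrib_left distrib_right sum.distrib)

lemma mat_form_add_right: "mat_form n A x (\<lambda>i. y i + y' i) = mat_form n A x y + mat_form n A x y'"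
  by (simp add: mat_form_def distrib_left distrib_right sum.distrib)

lemma mat_form_mult_left: "mat_form n A (\<lambda>i. x i * b) y = star b * mat_form n A x y"
  by (simp add: mat_form_def star_mult sum_distrib_left mult.assoc)

lemma mat_form_mult_right: "mat_form n A x (\<lambda>i. y i * b) = mat_form n A x y * b"
  by (simp add: mat_form_def sum_distrib_right mult.assoc)

lemma star_mat_form:
  assumes "\<And>i j. i < n \<Longrightarrow> j < n \<Longrightarrow> star (A i j) = A j i"
  shows "star (mat_form n A x y) = mat_form n A y x"
  unfolding mat_form_def star_sum
  by (subst sum.swap) (auto simp: star_mult assms mult.assoc intro!: sum.cong)

lemma mat_form_cauchy_schwarz:
  assumes "form_pos n A" and "\<And>i j. i < n \<Longrightarrow> j < n \<Longrightarrow> star (A i j) = A j i"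
  shows "(norm (mat_form n A x y))\<^sup>2 \<le> norm (mat_form n A x x) * norm (mat_form n A y y)"
proof (rule cstar_cauchy_schwarz)
  fix b d
  show "cstar_pos (star b * mat_form n A x x * b + star b * mat_form n A x y * d
      + star d * star (mat_form n A x y) * b + star d * mat_form n A y y * d)"
    using form_posD[OF assms(1), of "\<lambda>i. x i * b + y i * d"]
    by (simp add: mat_form_add_left mat_form_add_right mat_form_mult_left mat_form_mult_right
        star_mat_form[OF assms(2)] add.assoc mult.assoc distrib_left)
qed

text \<open>Polarization: the values of the form are self-adjoint, and testing it on vectors
  supported at \<open>i\<close> and \<open>j\<close> with coefficients (1, 1) and (1, \<i>)
  separates the two off-diagonal entries.\<close>

lemma form_pos_hermitian:
  fixes A :: "nat \<Rightarrow> nat \<Rightarrow> 'b::cstar_algebra"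
  assumes A: "form_pos n A" and ij: "i < n" "j < n"
  shows "star (A i j) = A j i"
proof -
  let ?e = "\<lambda>i (b::'b) k. if k = i then b else 0"
  have e: "mat_form n A (?e k b) (?e l d) = star b * A k l * d" if "k < n" "l < n" for k l b d
  proof -
    have "mat_form n A (?e k b) (?e l d) = (\<Sum>i<n. \<Sum>j<n. if j = l then if i = k then star b * A k l * d else 0 else 0)"
      unfolding mat_form_def by (intro sum.cong) auto
    then show ?thesis using that by simp
  qed
  have diag: "star (A k k) = A k k" if "k < n" for k
    using cstar_pos_self_adjoint[OF form_posD[OF A, of "?e k 1"]] that by (simp add: e)
  have sa: "star (star b * A i j * d + star d * A j i * b) = star b * A i j * d + star d * A j i * b" for b d
    using cstar_pos_self_adjoint[OF form_posD[OF A, of "\<lambda>k. ?e i b k + ?e j d k"]]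
    unfolding mat_form_add_left mat_form_add_right e[OF ij(1) ij(1)] e[OF ij] e[OF ij(2) ij(1)] e[OF ij(2) ij(2)]
    by (simp add: star_add star_mult diag ij algebra_simps)
  have 1: "star (A i j) + star (A j i) = A i j + A j i" using sa[of 1 1] by (simp add: star_add)
  have "\<i> *\<^sub>C (star (A j i) - star (A i j)) = \<i> *\<^sub>C (A i j - A j i)"
    using sa[of 1 "\<i> *\<^sub>C 1"]
    by (simp add: star_add star_scaleC mult_scaleC_left mult_scaleC_right
        scaleC_minus_left scaleC_diff_right star_diff)
  from arg_cong[OF this, of "\<lambda>x. (-\<i>) *\<^sub>C x"]
  have 2: "star (A j i) - star (A i j) = A i j - A j i" by (simp add: scaleC_scaleC)
  have "2 *\<^sub>R star (A i j) = 2 *\<^sub>R A j i"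
    using arg_cong2[OF 1 2, of "(-)"] by (simp add: scaleR_2)
  then show ?thesis by simp
qed

text \<open>Completing the square: \<open>star ?u * ?u\<close> produces the cross terms, and the
  second summand fills up its last term to \<open>m\<close> times \<open>star c * c\<close>.\<close>

lemma cstar_pos_cross_terms:
  fixes a :: "'b::cstar_algebra"
  assumes a: "norm a \<le> m" "m > 0"
  shows "cstar_pos (m *\<^sub>R (star b * b) + m *\<^sub>R (star c * c) - (star b * a * c + star c * star a * b))"
proof -
  let ?u = "sqrt m *\<^sub>R b - (1 / sqrt m) *\<^sub>R (a * c)"
  have "norm (star a * a) \<le> m\<^sup>2" using a by (simp add: cstar_identity power_mono)
  then have "cstar_pos ((1 / m) *\<^sub>R (star c * (m\<^sup>2 *\<^sub>R 1 - star a * a) * c))"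
    using a by (intro cstar_pos_scaleR cstar_pos_conj cstar_pos_norm_diff) (auto simp: star_mult)
  from cstar_pos_add[OF cstar_pos_star_mult[of ?u] this] show ?thesis
    using a by (simp add: star_diff star_mult algebra_simps power2_eq_square)
qed

text \<open>Each pair of mutually adjoint terms of the form is bounded by diagonal ones. Summing
  over all index pairs counts the form twice and the diagonal \<open>2 * n\<close> times.\<close>

lemma form_pos_upper_bound:
  fixes A :: "nat \<Rightarrow> nat \<Rightarrow> 'b::cstar_algebra"
  assumes A: "form_pos n A" and n: "n > 0"
  obtains r where "r > 0" "\<And>x. cstar_pos (r *\<^sub>R (\<Sum>i<n. star (x i) * x i) - mat_form n A x x)"
proof -
  \<comment> \<open>The 1 keeps \<open>?m\<close> positive, as the square completed in
    \<open>cstar_pos_cross_terms\<close> involves division by its root.\<close>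
  let ?m = "1 + (\<Sum>i<n. \<Sum>j<n. norm (A i j))"
  have le: "norm (A i j) \<le> ?m" if "i < n" "j < n" for i j
  proof -
    have "norm (A i j) \<le> (\<Sum>j<n. norm (A i j))" using that by (intro member_le_sum) auto
    also have "\<dots> \<le> (\<Sum>i<n. \<Sum>j<n. norm (A i j))"
      using that by (intro member_le_sum[of i _ "\<lambda>i. \<Sum>j<n. norm (A i j)"]) (auto intro: sum_nonneg)
    finally show ?thesis by simp
  qed
  have m: "?m > 0" by (intro add_pos_nonneg sum_nonneg) auto
  show thesis
  proof (rule that[of "real n * ?m"])
    show "real n * ?m > 0" using m n by simp
    fix x :: "nat \<Rightarrow> 'b"
    let ?N = "\<Sum>i<n. star (x i) * x i"
    have "cstar_pos (\<Sum>i<n. \<Sum>j<n. ?m *\<^sub>R (star (x i) * x i) + ?m *\<^sub>R (star (x j) * x j)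
        - (star (x i) * A i j * x j + star (x j) * star (A i j) * x i))"
      by (intro cstar_pos_sum cstar_pos_cross_terms m le) auto
    also have "(\<Sum>i<n. \<Sum>j<n. ?m *\<^sub>R (star (x i) * x i) + ?m *\<^sub>R (star (x j) * x j)
        - (star (x i) * A i j * x j + star (x j) * star (A i j) * x i))
      = real n *\<^sub>R ?m *\<^sub>R ?N + real n *\<^sub>R ?m *\<^sub>R ?N - (mat_form n A x x + mat_form n A x x)"
    proof -
      have "(\<Sum>i<n. \<Sum>j<n. ?m *\<^sub>R (star (x i) * x i)) = real n *\<^sub>R ?m *\<^sub>R ?N"
        by (simp only: sum_constant_scaleR card_lessThan scaleR_sum_right)
      moreover have "(\<Sum>i<n. \<Sum>j<n. ?m *\<^sub>R (star (x j) * x j)) = real n *\<^sub>R ?m *\<^sub>R ?N"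
        by (simp only: sum_constant_scaleR card_lessThan scaleR_sum_right)
      moreover have "(\<Sum>i<n. \<Sum>j<n. star (x j) * star (A i j) * x i) = mat_form n A x x"
        unfolding mat_form_def by (subst sum.swap) (auto intro!: sum.cong simp: form_pos_hermitian[OF A])
      ultimately show ?thesis
        unfolding sum_subtractf sum.distrib mat_form_def[symmetric] by simp
    qed
    finally have "cstar_pos ((1/2) *\<^sub>R (real n *\<^sub>R ?m *\<^sub>R ?N + real n *\<^sub>R ?m *\<^sub>R ?N - (mat_form n A x x + mat_form n A x x)))"
      by (intro cstar_pos_scaleR) auto
    then show "cstar_pos ((real n * ?m) *\<^sub>R ?N - mat_form n A x x)"
      by (simp only: scaleR_2[symmetric] scaleR_diff_right scaleR_scaleR) simp
  qed
qed

section \<open>Square roots of matrices\<close>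

primrec mat_power :: "nat \<Rightarrow> (nat \<Rightarrow> nat \<Rightarrow> 'b::cstar_algebra) \<Rightarrow> nat \<Rightarrow> nat \<Rightarrow> nat \<Rightarrow> 'b" where
  "mat_power n Z 0 i j = (if i = j then 1 else 0)"
| "mat_power n Z (Suc k) i j = (\<Sum>l<n. Z i l * mat_power n Z k l j)"

lemma mat_power_one: "j < n \<Longrightarrow> mat_power n Z (Suc 0) i j = Z i j"
  by (simp add: if_distrib[of "(*) _"] cong: if_cong)

lemma mat_power_add:
  assumes "i < n"
  shows "(\<Sum>l<n. mat_power n Z m i l * mat_power n Z k l j) = mat_power n Z (m + k) i j"
  using assms
proof (induction m arbitrary: i)
  case 0
  have "(\<Sum>l<n. mat_power n Z 0 i l * mat_power n Z k l j) = (\<Sum>l<n. if i = l then mat_power n Z k l j else 0)"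
    by (intro sum.cong) auto
  then show ?case using 0 by simp
next
  case (Suc m)
  have "(\<Sum>l<n. mat_power n Z (Suc m) i l * mat_power n Z k l j)
      = (\<Sum>l<n. \<Sum>p<n. Z i p * (mat_power n Z m p l * mat_power n Z k l j))"
    by (simp add: sum_distrib_right mult.assoc)
  also have "\<dots> = (\<Sum>p<n. Z i p * (\<Sum>l<n. mat_power n Z m p l * mat_power n Z k l j))"
    by (subst sum.swap) (simp add: sum_distrib_left)
  finally show ?case using Suc.IH by simp
qed

lemma star_mat_power:
  assumes Z: "\<And>i j. i < n \<Longrightarrow> j < n \<Longrightarrow> star (Z i j) = Z j i" and "i < n" "j < n"
  shows "star (mat_power n Z k i j) = mat_power n Z k j i"
  using assms(2,3)
proof (induction k arbitrary: i j)
  case (Suc k)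
  have "star (mat_power n Z (Suc k) i j) = (\<Sum>l<n. mat_power n Z k j l * Z l i)"
    using Suc by (auto simp: star_sum star_mult Z intro!: sum.cong)
  also have "\<dots> = (\<Sum>l<n. mat_power n Z k j l * mat_power n Z (Suc 0) l i)"
    using Suc.prems by (simp only: mat_power_one)
  also have "\<dots> = mat_power n Z (Suc k) j i" using mat_power_add[OF Suc.prems(2), of Z k "Suc 0" i] by simp
  finally show ?case .
qed simp

lemma norm_component_le:
  fixes x :: "nat \<Rightarrow> 'b::cstar_algebra"
  assumes "i < n" shows "(norm (x i))\<^sup>2 \<le> norm (\<Sum>i<n. star (x i) * x i)"
proof -
  have "norm (star (x i) * x i) \<le> norm (\<Sum>i<n. star (x i) * x i)"
  proof (rule norm_mono_cstar_pos)
    have "(\<Sum>i<n. star (x i) * x i) - star (x i) * x i = (\<Sum>i\<in>{..<n}-{i}. star (x i) * x i)"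
      using assms by (subst sum.remove[of _ i]) auto
    then show "cstar_pos ((\<Sum>i<n. star (x i) * x i) - star (x i) * x i)"
      by (simp add: cstar_pos_sum cstar_pos_star_mult)
  qed (rule cstar_pos_star_mult)
  then show ?thesis by (simp add: cstar_identity)
qed

text \<open>A form between \<open>0\<close> and the identity is a contraction, so the entries of its powers are
  bounded and the binomial series for the square root of its complement converges entrywise.\<close>

lemma norm_mat_power_le:
  fixes Z :: "nat \<Rightarrow> nat \<Rightarrow> 'b::cstar_algebra"
  assumes Z: "form_pos n Z" and Z1: "\<And>x. cstar_pos ((\<Sum>i<n. star (x i) * x i) - mat_form n Z x x)"
    and ij: "i < n" "j < n"
  shows "norm (mat_power n Z k i j) \<le> 1"
proof -
  let ?N = "\<lambda>x::nat \<Rightarrow> 'b. \<Sum>i<n. star (x i) * x i"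
  let ?Z = "\<lambda>y i. \<Sum>j<n. Z i j * y j"
  have le: "norm (mat_form n Z x x) \<le> norm (?N x)" for x
    by (rule norm_mono_cstar_pos) (use Z Z1 in \<open>auto simp: form_pos_def\<close>)
  have contr: "norm (?N (?Z y)) \<le> norm (?N y)" for y
  proof -
    \<comment> \<open>With this identity, Cauchy-Schwarz for the vectors \<open>?Z y\<close> and
      \<open>y\<close> has the square of \<open>norm (?N (?Z y))\<close> on its left and, by
      \<open>le\<close>, only one factor of it on its right.\<close>
    have e: "mat_form n Z (?Z y) y = ?N (?Z y)"
      by (simp add: mat_form_def sum_distrib_left mult.assoc)
    have "(norm (?N (?Z y)))\<^sup>2 \<le> norm (mat_form n Z (?Z y) (?Z y)) * norm (mat_form n Z y y)"
      using mat_form_cauchy_schwarz[OF Z form_pos_hermitian[OF Z], of "?Z y" y] unfolding e .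
    also have "\<dots> \<le> norm (?N (?Z y)) * norm (?N y)" by (intro mult_mono le) auto
    finally show ?thesis
      by (cases "norm (?N (?Z y)) = 0") (simp_all add: power2_eq_square)
  qed
  \<comment> \<open>Column \<open>j\<close> of the power arises from the \<open>j\<close>-th unit
    vector by applying the contraction \<open>k\<close> times.\<close>
  have "norm (?N (\<lambda>i. mat_power n Z k i j)) \<le> 1"
  proof (induction k)
    case 0
    have "?N (\<lambda>i. mat_power n Z 0 i j) = (\<Sum>i<n. if i = j then 1 else 0)"
      by (intro sum.cong) auto
    then show ?case using ij by (simp only:) simp
  next
    case (Suc k)
    show ?case using order.trans[OF contr Suc] by simp
  qed
  with norm_component_le[OF ij(1), of "\<lambda>i. mat_power n Z k i j"] have "(norm (mat_power n Z k i j))\<^sup>2 \<le> 1" by simp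
  then show ?thesis by (simp add: power2_le_iff_abs_le power_le_one_iff abs_square_le_1)
qed

text \<open>The binomial series in the powers of \<open>Z\<close> gives a hermitian \<open>Y\<close>
  with square \<open>1 - Z\<close>, so \<open>Y\<close> itself serves as the factor.\<close>

lemma mat_sqrt_one_minus:
  fixes Z :: "nat \<Rightarrow> nat \<Rightarrow> 'b::cstar_algebra"
  assumes Z: "form_pos n Z" and Z1: "\<And>x. cstar_pos ((\<Sum>i<n. star (x i) * x i) - mat_form n Z x x)"
  shows "matrix_pos n (\<lambda>i j. (if i = j then 1 else 0) - Z i j)"
proof -
  let ?P = "mat_power n Z"
  let ?f = "\<lambda>i j k. sqrt_coeff k *\<^sub>R ?P k i j"
  have sn: "summable (\<lambda>k. norm (?f i j k))" if "i < n" "j < n" for i j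
  proof (rule summable_comparison_test'[OF summable_abs_sqrt_coeff, of 0])
    show "norm (norm (?f i j k)) \<le> \<bar>sqrt_coeff k\<bar>" for k
      using mult_left_mono[OF norm_mat_power_le[OF Z Z1 that, of k], of "\<bar>sqrt_coeff k\<bar>"] by simp
  qed
  let ?Y = "\<lambda>i j. \<Sum>k. ?f i j k"
  have "(if i = j then 1 else 0) - Z i j = (\<Sum>l<n. star (?Y l i) * ?Y l j)" if ij: "i < n" "j < n" for i j
  proof -
    have st: "star (?Y l i) = ?Y i l" if "l < n" for l
      using bounded_linear.suminf[OF bounded_linear_star summable_norm_cancel[OF sn], of l i] that ij
      by (simp add: star_mat_power form_pos_hermitian[OF Z])
    have "(\<lambda>k. \<Sum>m\<le>k. ?f i l m * ?f l j (k - m)) sums (?Y i l * ?Y l j)" if "l < n" for l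
      using Cauchy_product_sums[OF sn sn] that ij by blast
    then have "(\<lambda>k. \<Sum>l<n. \<Sum>m\<le>k. ?f i l m * ?f l j (k - m)) sums (\<Sum>l<n. ?Y i l * ?Y l j)"
      by (intro sums_sum) auto
    also have "(\<lambda>k. \<Sum>l<n. \<Sum>m\<le>k. ?f i l m * ?f l j (k - m))
        = (\<lambda>k. (\<Sum>m\<le>k. sqrt_coeff m * sqrt_coeff (k - m)) *\<^sub>R ?P k i j)"
    proof
      fix k
      have "(\<Sum>l<n. \<Sum>m\<le>k. ?f i l m * ?f l j (k - m))
          = (\<Sum>m\<le>k. (sqrt_coeff m * sqrt_coeff (k - m)) *\<^sub>R (\<Sum>l<n. ?P m i l * ?P (k - m) l j))"
        by (simp add: scaleR_sum_right mult.commute) (rule sum.swap)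
      also have "\<dots> = (\<Sum>m\<le>k. (sqrt_coeff m * sqrt_coeff (k - m)) *\<^sub>R ?P k i j)"
        using ij by (intro sum.cong) (auto simp: mat_power_add)
      finally show "(\<Sum>l<n. \<Sum>m\<le>k. ?f i l m * ?f l j (k - m))
          = (\<Sum>m\<le>k. sqrt_coeff m * sqrt_coeff (k - m)) *\<^sub>R ?P k i j"
        by (simp add: scaleR_sum_left)
    qed
    also have "\<dots> = (\<lambda>k. if k \<in> {0,1} then (if k = 0 then ?P 0 i j else - Z i j) else 0)"
      using mat_power_one[OF ij(2), of Z i] by (auto simp: sqrt_coeff_convolution simp del: mat_power.simps)
    finally have "(\<lambda>k. if k \<in> {0,1::nat} then (if k = 0 then ?P 0 i j else - Z i j) else 0) sums (\<Sum>l<n. ?Y i l * ?Y l j)" .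
    moreover have "(\<lambda>k. if k \<in> {0,1::nat} then (if k = 0 then ?P 0 i j else - Z i j) else 0) sums
        (\<Sum>k\<in>{0,1::nat}. if k = 0 then ?P 0 i j else - Z i j)"
      by (rule sums_If_finite_set) simp
    ultimately have "(\<Sum>l<n. ?Y i l * ?Y l j) = (\<Sum>k\<in>{0,1::nat}. if k = 0 then ?P 0 i j else - Z i j)"
      by (rule sums_unique2)
    moreover have "(\<Sum>l<n. star (?Y l i) * ?Y l j) = (\<Sum>l<n. ?Y i l * ?Y l j)" 
      by (intro sum.cong) (auto simp: st)
    ultimately show ?thesis by simp
  qed
  then show ?thesis unfolding matrix_pos_def by (intro exI[of _ ?Y] allI impI)
qed

text \<open>For the converse direction, an upper bound \<open>r\<close> of the form \<open>A\<close>
  makes \<open>1 - (1 / r) A\<close> lie between 0 and 1; the root of its complement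
  \<open>(1 / r) A\<close>, scaled by \<open>sqrt r\<close>, factorizes \<open>A\<close>.\<close>

lemma matrix_pos_iff_form_pos: "matrix_pos n A \<longleftrightarrow> form_pos n A"
proof
  assume "matrix_pos n A"
  then obtain X where X: "\<And>i j. i < n \<Longrightarrow> j < n \<Longrightarrow> A i j = (\<Sum>k<n. star (X k i) * X k j)"
    by (auto simp: matrix_pos_def)
  show "form_pos n A" unfolding form_pos_def
  proof
    fix x
    have "mat_form n A x x = (\<Sum>i<n. \<Sum>j<n. \<Sum>k<n. star (x i) * star (X k i) * (X k j * x j))"
      by (simp add: mat_form_def X sum_distrib_left sum_distrib_right mult.assoc)
    also have "\<dots> = (\<Sum>k<n. \<Sum>i<n. \<Sum>j<n. star (x i) * star (X k i) * (X k j * x j))"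
      by (subst sum.swap, subst sum.swap[of _ "{..<n}"]) simp
    also have "\<dots> = (\<Sum>k<n. star (\<Sum>i<n. X k i * x i) * (\<Sum>j<n. X k j * x j))"
      by (simp add: star_sum star_mult sum_product)
    finally show "cstar_pos (mat_form n A x x)" by (simp add: cstar_pos_sum cstar_pos_star_mult)
  qed
next
  assume A: "form_pos n A"
  show "matrix_pos n A"
  proof (cases "n = 0")
    case False
    then obtain r where r: "r > 0" and le: "\<And>x. cstar_pos (r *\<^sub>R (\<Sum>i<n. star (x i) * x i) - mat_form n A x x)"
      using form_pos_upper_bound[OF A] by blast
    let ?Z = "\<lambda>i j. (if i = j then 1 else 0) - (1 / r) *\<^sub>R A i j"
    have e: "mat_form n ?Z x x = (\<Sum>i<n. star (x i) * x i) - (1 / r) *\<^sub>R mat_form n A x x" for x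
    proof -
      have "mat_form n ?Z x x = (\<Sum>i<n. \<Sum>j<n. (if i = j then star (x i) * x j else 0) - (1 / r) *\<^sub>R (star (x i) * A i j * x j))"
        unfolding mat_form_def by (intro sum.cong refl) (auto simp: algebra_simps)
      then show ?thesis by (simp add: sum_subtractf mat_form_def scaleR_sum_right)
    qed
    have "matrix_pos n (\<lambda>i j. (if i = j then 1 else 0) - ?Z i j)"
    proof (rule mat_sqrt_one_minus)
      show "form_pos n ?Z" unfolding form_pos_def e
      proof
        fix x show "cstar_pos ((\<Sum>i<n. star (x i) * x i) - (1 / r) *\<^sub>R mat_form n A x x)"
          using cstar_pos_scaleR[OF le, of "1 / r" x] r by (simp add: scaleR_diff_right)
      qed
      show "cstar_pos ((\<Sum>i<n. star (x i) * x i) - mat_form n ?Z x x)" for x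
        unfolding e using cstar_pos_scaleR[OF form_posD[OF A], of "1 / r" x] r by simp
    qed
    then obtain X where X: "\<And>i j. i < n \<Longrightarrow> j < n \<Longrightarrow> (1 / r) *\<^sub>R A i j = (\<Sum>k<n. star (X k i) * X k j)"
      by (auto simp: matrix_pos_def)
    have "A i j = (\<Sum>k<n. star (sqrt r *\<^sub>R X k i) * (sqrt r *\<^sub>R X k j))" if "i < n" "j < n" for i j
      using arg_cong[OF X[OF that], of "scaleR r"] r by (simp add: scaleR_sum_right)
    then show ?thesis unfolding matrix_pos_def by (intro exI[of _ "\<lambda>k i. sqrt r *\<^sub>R X k i"]) auto
  qed (simp add: matrix_pos_def)
qed

text \<open>A factorization writes a positive matrix as a sum, over the rows of \<open>X\<close>, of
  matrices of the special form tested on the right.\<close>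

lemma completely_positive_iff:
  fixes \<phi> :: "'b::cstar_algebra \<Rightarrow> 'b"
  assumes lin: "complex_linear \<phi>"
  shows "completely_positive \<phi> \<longleftrightarrow> (\<forall>n a. form_pos n (\<lambda>i j. \<phi> (star (a i) * a j)))"
proof
  assume cp: "completely_positive \<phi>"
  show "\<forall>n a. form_pos n (\<lambda>i j. \<phi> (star (a i) * a j))"
  proof (intro allI)
    fix n and a :: "nat \<Rightarrow> 'b"
    \<comment> \<open>The factor has \<open>a\<close> as its row 0 and zeros elsewhere.\<close>
    have "matrix_pos n (\<lambda>i j. star (a i) * a j)" unfolding matrix_pos_def
    proof (intro exI allI impI)
      fix i j assume "i < n"
      then have "(\<Sum>k<n. star (if k = 0 then a i else 0) * (if k = 0 then a j else 0))
          = (\<Sum>k<n. if k = 0 then star (a i) * a j else 0)" by (intro sum.cong) auto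
      then show "star (a i) * a j = (\<Sum>k<n. star (if k = 0 then a i else 0) * (if k = 0 then a j else 0))"
        using \<open>i < n\<close> by simp
    qed
    then show "form_pos n (\<lambda>i j. \<phi> (star (a i) * a j))"
      using cp by (simp add: completely_positive_def matrix_pos_iff_form_pos)
  qed
next
  assume pos: "\<forall>n a. form_pos n (\<lambda>i j. \<phi> (star (a i) * a j))"
  have add: "\<phi> (x + y) = \<phi> x + \<phi> y" for x y using lin by (simp add: complex_linear_def)
  have sum: "\<phi> (\<Sum>k<n. f k) = (\<Sum>k<n. \<phi> (f k))" for f and n :: nat
    by (induction n) (use add add[of 0 0] in auto)
  have "form_pos n (\<lambda>i j. \<phi> (A i j))" if A: "matrix_pos n A" for n A
  proof -
    obtain X where X: "\<And>i j. i < n \<Longrightarrow> j < n \<Longrightarrow> A i j = (\<Sum>k<n. star (X k i) * X k j)"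
      using A by (auto simp: matrix_pos_def)
    have "mat_form n (\<lambda>i j. \<phi> (A i j)) x x
        = (\<Sum>k<n. mat_form n (\<lambda>i j. \<phi> (star (X k i) * X k j)) x x)" for x
    proof -
      have "mat_form n (\<lambda>i j. \<phi> (A i j)) x x
          = (\<Sum>i<n. \<Sum>j<n. \<Sum>k<n. star (x i) * \<phi> (star (X k i) * X k j) * x j)"
        by (simp add: mat_form_def X sum sum_distrib_left sum_distrib_right)
      also have "\<dots> = (\<Sum>k<n. \<Sum>i<n. \<Sum>j<n. star (x i) * \<phi> (star (X k i) * X k j) * x j)"
        by (subst sum.swap, subst sum.swap[of _ "{..<n}"]) simp
      finally show ?thesis by (simp add: mat_form_def)
    qed
    then show ?thesis using pos by (simp add: form_pos_def cstar_pos_sum)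
  qed
  then show "completely_positive \<phi>"
    using lin by (simp add: completely_positive_def matrix_pos_iff_form_pos)
qed

section \<open>Positive maps\<close>

lemma complex_linear_add: "complex_linear \<phi> \<Longrightarrow> \<phi> (x + y) = \<phi> x + \<phi> y"
  by (simp add: complex_linear_def)

lemma complex_linear_scaleC: "complex_linear \<phi> \<Longrightarrow> \<phi> (a *\<^sub>C x) = a *\<^sub>C \<phi> x"
  by (simp add: complex_linear_def)

lemma complex_linear_imp_linear: "complex_linear \<phi> \<Longrightarrow> linear \<phi>"
  by (rule linearI) (simp_all add: complex_linear_def flip: scaleC_of_real)

text \<open>A self-adjoint element lies between minus and plus its norm, and positivity preserves
  these bounds. The factor 2 comes from treating the two cartesian parts separately.\<close>

lemma positive_map_bound:
  fixes \<phi> :: "'b::cstar_algebra \<Rightarrow> 'b"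
  assumes lin: "complex_linear \<phi>" and pos: "\<And>a. cstar_pos a \<Longrightarrow> cstar_pos (\<phi> a)"
  shows "norm (\<phi> a) \<le> 2 * norm (\<phi> 1) * norm a"
proof -
  interpret \<phi>: linear \<phi> by (rule complex_linear_imp_linear[OF lin])
  have one: "cstar_pos (1::'b)" using cstar_pos_star_mult[of "1::'b"] by simp
  have sa: "norm (\<phi> h) \<le> norm (\<phi> 1) * norm h" if h: "star h = h" for h
  proof (rule norm_le_of_order_bounds)
    have up: "cstar_pos (norm h *\<^sub>R (norm (\<phi> 1) *\<^sub>R 1 - \<phi> 1))"
      by (intro cstar_pos_scaleR cstar_pos_norm_diff cstar_pos_self_adjoint pos one) auto
    have "cstar_pos (\<phi> (norm h *\<^sub>R 1 - h))" by (intro pos cstar_pos_norm_diff h) simp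
    from cstar_pos_add[OF up this] show "cstar_pos ((norm (\<phi> 1) * norm h) *\<^sub>R 1 - \<phi> h)"
      by (simp add: \<phi>.diff \<phi>.scale algebra_simps)
    have "cstar_pos (\<phi> (norm h *\<^sub>R 1 - (- h)))" by (intro pos cstar_pos_norm_diff) (simp_all add: h)
    from cstar_pos_add[OF up this] show "cstar_pos ((norm (\<phi> 1) * norm h) *\<^sub>R 1 + \<phi> h)"
      by (simp add: \<phi>.add \<phi>.scale algebra_simps)
  qed simp
  obtain h k where hk: "star h = h" "star k = k" "a = h + \<i> *\<^sub>C k" "norm h \<le> norm a" "norm k \<le> norm a"
    by (rule cartesian_decomposition)
  have "norm (\<phi> a) \<le> norm (\<phi> h) + norm (\<phi> k)"
    unfolding hk(3) using norm_triangle_ineq[of "\<phi> h" "\<i> *\<^sub>C \<phi> k"]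
    by (simp add: \<phi>.add complex_linear_scaleC[OF lin] norm_scaleC)
  also have "\<dots> \<le> norm (\<phi> 1) * norm a + norm (\<phi> 1) * norm a"
    by (intro add_mono order.trans[OF sa] mult_left_mono hk norm_ge_zero)
  finally show ?thesis by (simp add: mult.commute)
qed

lemma completely_positive_imp_positive:
  assumes "completely_positive \<phi>" "cstar_pos a" shows "cstar_pos (\<phi> a)"
proof -
  have "matrix_pos 1 (\<lambda>i j. a)" using assms(2) by (auto simp: matrix_pos_def cstar_pos_def)
  then have "matrix_pos 1 (\<lambda>i j. \<phi> a)" using assms(1) by (auto simp: completely_positive_def)
  then show ?thesis by (auto simp: matrix_pos_def cstar_pos_def)
qed

lemma completely_positive_bound:
  "completely_positive \<phi> \<Longrightarrow> norm (\<phi> a) \<le> 2 * norm (\<phi> 1) * norm a"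
  by (rule positive_map_bound) (auto simp: completely_positive_imp_positive completely_positive_def)

text \<open>Riemann sums stay in the cone, and the cone is closed.\<close>

lemma cstar_pos_integral:
  fixes f :: "real \<Rightarrow> 'b::cstar_algebra"
  assumes I: "(f has_integral I) {a..b}" and pos: "\<And>x. x \<in> {a..b} \<Longrightarrow> cstar_pos (f x)"
  shows "cstar_pos I"
proof -
  have "\<exists>v\<in>{v. cstar_pos v}. dist v I < e" if e: "e > 0" for e
  proof -
    obtain g where g: "gauge g" "\<forall>D. D tagged_division_of {a..b} \<and> g fine D \<longrightarrow>
        norm ((\<Sum>(x,k)\<in>D. measure lborel k *\<^sub>R f x) - I) < e"
      using I[unfolded has_integral_real, THEN spec, THEN mp, OF e] by (elim exE conjE) (rule that)
    obtain D where D: "D tagged_division_of {a..b}" "g fine D"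
      using fine_division_exists_real[OF g(1)] by blast
    have "cstar_pos (\<Sum>(x,k)\<in>D. measure lborel k *\<^sub>R f x)"
    proof (rule cstar_pos_sum, clarify)
      fix x k assume "(x, k) \<in> D"
      then have "x \<in> {a..b}" using tagged_division_ofD(2,3)[OF D(1)] by blast
      then show "cstar_pos (measure lborel k *\<^sub>R f x)" by (intro cstar_pos_scaleR pos) auto
    qed
    then show ?thesis using g(2) D by (intro bexI) (auto simp: dist_norm)
  qed
  then have "I \<in> closure {v. cstar_pos v}" by (simp add: closure_approachable)
  then show ?thesis using closure_closed[OF cstar_pos_closed] by auto
qed

section \<open>One-parameter semigroups\<close>

lemma has_vector_derivative_iff_tendsto:
  "(f has_vector_derivative D) (at x within S) \<longleftrightarrow>
    ((\<lambda>y. inverse (y - x) *\<^sub>R (f y - f x)) \<longlongrightarrow> D) (at x within S)"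
proof -
  have "(f has_vector_derivative D) (at x within S) \<longleftrightarrow>
    ((\<lambda>y. norm ((f y - f x) - (y - x) *\<^sub>R D) / norm (y - x)) \<longlongrightarrow> 0) (at x within S)"
    unfolding has_vector_derivative_def has_derivative_iff_norm by (simp add: bounded_linear_scaleR_left)
  also have "\<dots> \<longleftrightarrow> ((\<lambda>y. norm (inverse (y - x) *\<^sub>R (f y - f x) - D)) \<longlongrightarrow> 0) (at x within S)"
  proof (rule tendsto_cong, unfold eventually_at_filter, rule always_eventually, intro allI impI)
    fix y assume "y \<noteq> x"
    then have "inverse (y - x) *\<^sub>R (f y - f x) - D = inverse (y - x) *\<^sub>R ((f y - f x) - (y - x) *\<^sub>R D)"
      by (simp add: scaleR_diff_right)
    then show "norm ((f y - f x) - (y - x) *\<^sub>R D) / norm (y - x) = norm (inverse (y - x) *\<^sub>R (f y - f x) - D)"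
      by (simp only: norm_scaleR) (simp add: divide_inverse mult.commute abs_inverse)
  qed
  also have "\<dots> \<longleftrightarrow> ((\<lambda>y. inverse (y - x) *\<^sub>R (f y - f x)) \<longlongrightarrow> D) (at x within S)"
    unfolding tendsto_norm_zero_iff by (rule LIM_zero_iff)
  finally show ?thesis .
qed

text \<open>The mean \<open>V = (1/\<delta>) \<integral>\<^sub>0\<^sup>\<delta> U\<^sub>r dr\<close> has values in the domain of the generator, and it is surjective since
  \<open>\<parallel>V - id\<parallel> \<le> 1/2\<close>.\<close>

lemma semigroup_differentiable:
  fixes U :: "real \<Rightarrow> 'a::banach \<Rightarrow> 'a"
  assumes lin: "\<And>t. t \<ge> 0 \<Longrightarrow> bounded_linear (U t)"
    and semigroup: "\<And>s t x. s \<ge> 0 \<Longrightarrow> t \<ge> 0 \<Longrightarrow> U (s + t) x = U s (U t x)"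
    and cont: "\<And>x. continuous_on {0..} (\<lambda>t. U t x)"
    and \<delta>: "\<delta> > 0" and near: "\<And>t x. 0 \<le> t \<Longrightarrow> t \<le> \<delta> \<Longrightarrow> norm (U t x - x) \<le> norm x / 2"
  obtains l where "((\<lambda>t. U t y) has_vector_derivative l) (at 0 within {0..})"
proof -
  have cont': "continuous_on {a..b} (\<lambda>t. U t x)" if "a \<ge> 0" for a b x
    by (rule continuous_on_subset[OF cont]) (use that in auto)
  have int: "(\<lambda>r. U r x) integrable_on {a..b}" if "a \<ge> 0" for a b x
    by (rule integrable_continuous_real[OF cont'[OF that]])
  define V where "V x = (1/\<delta>) *\<^sub>R integral {0..\<delta>} (\<lambda>r. U r x)" for x
  have V_near: "norm (x - V x) \<le> norm x / 2" for x
  proof -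
    have "V x - x = (1/\<delta>) *\<^sub>R integral {0..\<delta>} (\<lambda>r. U r x - x)"
      using \<delta> integral_diff[OF int integrable_const_ivl, of 0 \<delta> x x]
      by (simp add: V_def scaleR_diff_right)
    moreover have "norm (integral {0..\<delta>} (\<lambda>r. U r x - x)) \<le> norm x / 2 * (\<delta> - 0)"
      using \<delta> near by (intro integral_bound continuous_intros cont') auto
    ultimately show ?thesis using \<delta> by (simp add: norm_minus_commute field_simps)
  qed
  have linU: "linear (U r)" if "r \<ge> 0" for r using lin[OF that] by (rule bounded_linear.linear)
  have "V (x + x') = V x + V x'" for x x'
  proof -
    have "integral {0..\<delta>} (\<lambda>r. U r (x + x')) = integral {0..\<delta>} (\<lambda>r. U r x + U r x')"
      by (rule integral_cong) (simp add: linear_add[OF linU])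
    then show ?thesis by (simp add: V_def integral_add int scaleR_add_right)
  qed
  moreover have "V (c *\<^sub>R x) = c *\<^sub>R V x" for c x
  proof -
    have "integral {0..\<delta>} (\<lambda>r. U r (c *\<^sub>R x)) = integral {0..\<delta>} (\<lambda>r. c *\<^sub>R U r x)"
      by (rule integral_cong) (simp add: linear_scale[OF linU])
    then show ?thesis by (simp add: V_def)
  qed
  moreover have "norm (V x) \<le> norm x * 2" for x
    using V_near[of x] norm_triangle_ineq2[of "V x" x] norm_ge_zero[of x]
    unfolding norm_minus_commute[of "V x"] by linarith
  ultimately have V: "bounded_linear V" by (intro bounded_linear_intro)
  \<comment> \<open>Neumann series: \<open>V (Y n) = Y n - Y (Suc n)\<close>, so applying
    \<open>V\<close> to the sum of the \<open>Y n\<close> telescopes to \<open>y\<close>.\<close>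
  define Y where "Y n = ((\<lambda>x. x - V x) ^^ n) y" for n
  have Y_Suc: "Y (Suc n) = Y n - V (Y n)" for n by (simp add: Y_def)
  have Y_le: "norm (Y n) \<le> norm y * (1/2) ^ n" for n
  proof (induction n)
    case (Suc n)
    then show ?case using V_near[of "Y n"] by (simp add: Y_Suc)
  qed (simp add: Y_def)
  have "summable (\<lambda>n. norm y * (1/2) ^ n)" by (intro summable_mult summable_geometric) simp
  then have sY: "summable Y" by (rule summable_comparison_test'[of _ 0]) (use Y_le in auto)
  define x where "x = suminf Y"
  have "(\<lambda>n. V (Y n)) sums V x"
    unfolding x_def by (rule bounded_linear.sums[OF V summable_sums[OF sY]])
  moreover have "(\<lambda>n. V (Y n)) = (\<lambda>n. Y n - Y (Suc n))" by (simp add: Y_Suc)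
  moreover have "(\<lambda>n. Y n - Y (Suc n)) sums (Y 0 - 0)"
    by (rule telescope_sums'[OF summable_LIMSEQ_zero[OF sY]])
  ultimately have Vx: "V x = y" by (simp add: sums_unique2 Y_def)
  define G where "G u = integral {0..u} (\<lambda>r. U r x)" for u
  have G: "(G has_vector_derivative U u x) (at u within {0..})" if "u \<ge> 0" for u
  proof -
    have "(G has_vector_derivative U u x) (at u within {0..u+1})"
      unfolding G_def using that by (intro integral_has_vector_derivative cont') auto
    also have "at u within {0..u+1} = at u within {0..}"
      by (rule at_within_nhd[of _ "{..<u+1}"]) auto
    finally show ?thesis .
  qed
  \<comment> \<open>The operator \<open>U t\<close> shifts the interval of the mean, so the orbit of
    \<open>y = V x\<close> is a difference of values of the primitive \<open>G\<close> and hence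
    differentiable.\<close>
  have e: "U t y = (1/\<delta>) *\<^sub>R (G (t + \<delta>) - G t)" if t: "t \<ge> 0" for t
  proof -
    have "U t (integral {0..\<delta>} (\<lambda>r. U r x)) = integral {0..\<delta>} (U t \<circ> (\<lambda>r. U r x))"
      by (rule integral_linear[symmetric, OF int lin[OF t]]) simp
    also have "\<dots> = integral {0..\<delta>} ((\<lambda>r. U r x) \<circ> (+) t)"
      by (rule integral_cong) (simp add: semigroup t)
    also have "\<dots> = integral {t..t + \<delta>} (\<lambda>r. U r x)"
      unfolding integral_shift_Icc_real by (simp add: add.commute)
    also have "\<dots> = G (t + \<delta>) - G t"
      using Henstock_Kurzweil_Integration.integral_combine[where a=0 and c=t and b="t + \<delta>" and f="\<lambda>r. U r x"] t \<delta> int[where a=0 and b="t + \<delta>"]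
      by (simp add: G_def algebra_simps)
    finally show ?thesis
      using linear_scale[OF linU[OF t], of "1/\<delta>" "integral {0..\<delta>} (\<lambda>r. U r x)"] Vx
      by (simp add: V_def)
  qed
  have "((G \<circ> (\<lambda>t. t + \<delta>)) has_vector_derivative 1 *\<^sub>R U \<delta> x) (at 0 within {0..})"
  proof (rule vector_diff_chain_within)
    show "((\<lambda>t. t + \<delta>) has_vector_derivative 1) (at 0 within {0..})"
      by (auto intro!: derivative_eq_intros)
    show "(G has_vector_derivative U \<delta> x) (at (0 + \<delta>) within (\<lambda>t. t + \<delta>) ` {0..})"
      using G[of \<delta>] \<delta> by (auto intro!: has_vector_derivative_within_subset[of _ _ _ "{0..}"])
  qed
  then have "((\<lambda>t. G (t + \<delta>)) has_vector_derivative U \<delta> x) (at 0 within {0..})" by (simp add: o_def)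
  from has_vector_derivative_diff[OF this G[of 0]]
  have "((\<lambda>t. (1/\<delta>) *\<^sub>R (G (t + \<delta>) - G t)) has_vector_derivative (1/\<delta>) *\<^sub>R (U \<delta> x - U 0 x)) (at 0 within {0..})"
    by (intro bounded_linear.has_vector_derivative[OF bounded_linear_scaleR_right]) simp
  then have "((\<lambda>t. U t y) has_vector_derivative (1/\<delta>) *\<^sub>R (U \<delta> x - U 0 x)) (at 0 within {0..})"
    by (rule has_vector_derivative_transform[rotated 2]) (simp_all add: e)
  then show thesis by (rule that)
qed

text \<open>Joint continuity: strong continuity moves the time at the fixed vector \<open>x\<close>,
  and the local bound controls replacing \<open>v y\<close> by \<open>x\<close>.\<close>

lemma semigroup_tendsto:
  fixes U :: "real \<Rightarrow> 'a::real_normed_vector \<Rightarrow> 'a"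
  assumes lin: "\<And>t. t \<ge> 0 \<Longrightarrow> linear (U t)"
    and cont: "\<And>x. continuous_on {0..} (\<lambda>t. U t x)"
    and bound: "\<And>t x. 0 \<le> t \<Longrightarrow> t \<le> \<tau> \<Longrightarrow> norm (U t x) \<le> M * norm x"
    and \<sigma>: "(\<sigma> \<longlongrightarrow> s) F" "eventually (\<lambda>y. \<sigma> y \<in> {0..\<tau>}) F" "s \<in> {0..\<tau>}"
    and v: "(v \<longlongrightarrow> x) F"
  shows "((\<lambda>y. U (\<sigma> y) (v y)) \<longlongrightarrow> U s x) F"
proof -
  have "((\<lambda>y. U (\<sigma> y) (v y) - U (\<sigma> y) x) \<longlongrightarrow> 0) F"
  proof (rule Lim_null_comparison)
    show "((\<lambda>y. M * norm (v y - x)) \<longlongrightarrow> 0) F"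
      by (intro tendsto_mult_right_zero tendsto_norm_zero LIM_zero v)
    show "eventually (\<lambda>y. norm (U (\<sigma> y) (v y) - U (\<sigma> y) x) \<le> M * norm (v y - x)) F"
      using \<sigma>(2)
    proof eventually_elim
      case (elim y)
      then show ?case using bound[of "\<sigma> y" "v y - x"] lin[of "\<sigma> y"] by (simp add: linear_diff)
    qed
  qed
  moreover have "((\<lambda>y. U (\<sigma> y) x) \<longlongrightarrow> U s x) F"
    by (rule continuous_on_tendsto_compose[OF cont \<sigma>(1)])
       (use \<sigma> in \<open>auto elim: eventually_mono\<close>)
  ultimately have "((\<lambda>y. (U (\<sigma> y) (v y) - U (\<sigma> y) x) + U (\<sigma> y) x) \<longlongrightarrow> 0 + U s x) F"
    by (rule tendsto_add)
  then show ?thesis by simp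
qed

text \<open>The generator is only a one-sided derivative at 0. Factoring out
  \<open>U (min s y)\<close> turns the difference quotient on either side of \<open>s\<close> into a
  forward quotient at the time \<open>\<bar>y - s\<bar>\<close>, which handles both sides at
  once.\<close>

lemma semigroup_product_derivative:
  fixes U :: "real \<Rightarrow> 'a::real_normed_vector \<Rightarrow> 'a"
  assumes lin: "\<And>t. t \<ge> 0 \<Longrightarrow> linear (U t)" and U0: "\<And>x. U 0 x = x"
    and semigroup: "\<And>s t x. s \<ge> 0 \<Longrightarrow> t \<ge> 0 \<Longrightarrow> U (s + t) x = U s (U t x)"
    and cont: "\<And>x. continuous_on {0..} (\<lambda>t. U t x)"
    and bound: "\<And>t x. 0 \<le> t \<Longrightarrow> t \<le> \<tau> \<Longrightarrow> norm (U t x) \<le> M * norm x"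
    and gen: "\<And>x. ((\<lambda>t. U t x) has_vector_derivative L x) (at 0 within {0..})"
    and s: "s \<in> {0..\<tau>}" and h: "(h has_vector_derivative h') (at s within {0..\<tau>})"
  shows "((\<lambda>t. U t (h t)) has_vector_derivative U s (L (h s) + h')) (at s within {0..\<tau>})"
proof -
  let ?F = "at s within {0..\<tau>}"
  note tends = semigroup_tendsto[OF lin cont bound]
  have ev: "eventually (\<lambda>y. y \<in> {0..\<tau>} \<and> y \<noteq> s) ?F" by (simp add: eventually_at_topological)  auto
  have 1: "((\<lambda>y. U y (inverse (y - s) *\<^sub>R (h y - h s))) \<longlongrightarrow> U s h') ?F"
    using h unfolding has_vector_derivative_iff_tendsto
    by (intro tends[where \<tau>=\<tau>]) (use ev s in \<open>auto elim: eventually_mono\<close>)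
  let ?q = "\<lambda>t. inverse t *\<^sub>R (U t (h s) - h s)"
  have q: "(?q \<longlongrightarrow> L (h s)) (at 0 within {0..})"
    using gen[of "h s"] unfolding has_vector_derivative_iff_tendsto by (simp add: U0)
  have abs: "filterlim (\<lambda>y. \<bar>y - s\<bar>) (at 0 within {0..}) ?F"
  proof -
    have "((\<lambda>y. \<bar>y - s\<bar>) \<longlongrightarrow> \<bar>s - s\<bar>) ?F" by (intro tendsto_intros)
    then show ?thesis by (simp add: filterlim_at) (use ev in \<open>auto elim: eventually_mono\<close>)
  qed
  have 2: "((\<lambda>y. U (min s y) (?q \<bar>y - s\<bar>)) \<longlongrightarrow> U s (L (h s))) ?F"
  proof (rule tends[where \<tau>=\<tau>])
    show "((\<lambda>y. ?q \<bar>y - s\<bar>) \<longlongrightarrow> L (h s)) ?F" by (rule filterlim_compose[OF q abs])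
    have "((\<lambda>y. min s y) \<longlongrightarrow> min s s) ?F" by (intro tendsto_intros)
    then show "((\<lambda>y. min s y) \<longlongrightarrow> s) ?F" by simp
  qed (use ev s in \<open>auto elim: eventually_mono\<close>)
  have "((\<lambda>y. U (min s y) (?q \<bar>y - s\<bar>) + U y (inverse (y - s) *\<^sub>R (h y - h s)))
      \<longlongrightarrow> U s (L (h s)) + U s h') ?F"
    by (rule tendsto_add[OF 2 1])
  then have "((\<lambda>y. inverse (y - s) *\<^sub>R (U y (h y) - U s (h s))) \<longlongrightarrow> U s (L (h s)) + U s h') ?F"
  proof (rule Lim_transform_eventually)
    show "eventually (\<lambda>y. U (min s y) (?q \<bar>y - s\<bar>) + U y (inverse (y - s) *\<^sub>R (h y - h s))
        = inverse (y - s) *\<^sub>R (U y (h y) - U s (h s))) ?F"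
      using ev
    proof eventually_elim
      case (elim y)
      have ly: "linear (U y)" and ls: "linear (U s)" using lin elim s by auto
      have "U (min s y) (?q \<bar>y - s\<bar>) = inverse (y - s) *\<^sub>R (U y (h s) - U s (h s))"
      proof (cases "y > s")
        case True
        then show ?thesis using semigroup[of s "y - s" "h s"] s
          by (simp add: linear_scale[OF ls] linear_diff[OF ls])
      next
        case False
        then have "U (min s y) (?q \<bar>y - s\<bar>) = inverse (s - y) *\<^sub>R (U s (h s) - U y (h s))"
          using semigroup[of y "s - y" "h s"] elim
          by (simp add: linear_scale[OF ly] linear_diff[OF ly] min_def)
        also have "inverse (s - y) = - inverse (y - s)" by (metis inverse_minus_eq minus_diff_eq)
        finally show ?thesis by (simp add: scaleR_diff_right)
      qed
      then show ?case by (simp add: linear_scale[OF ly] linear_diff[OF ly] scaleR_diff_right)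
    qed
  qed
  then show ?thesis
    unfolding has_vector_derivative_iff_tendsto using s lin[of s] by (simp add: linear_add)
qed

section \<open>The correspondence of a completely positive map\<close>

text \<open>Writing \<open>\<zeta>\<close> for the cyclic vector with \<open>\<langle>\<zeta>, b\<zeta>\<rangle> = \<phi> b\<close>, an element \<open>x\<close> of the correspondence is
  represented by the function \<open>c \<mapsto> \<langle>c\<zeta>, x\<rangle>\<close>. The list \<open>p\<close> stands for the vector
  \<open>x = \<Sum>(a,b)\<in>p. a\<zeta>b\<close>, with function \<open>span_fun p\<close>, and \<open>pairing p g\<close> for \<open>\<langle>x, g\<rangle>\<close>, which makes sense for
  an arbitrary function \<open>g\<close>.\<close>

locale cp_map =
  fixes \<phi> :: "'b::cstar_algebra \<Rightarrow> 'b"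
  assumes lin: "complex_linear \<phi>"
    and pos: "\<And>n a. form_pos n (\<lambda>i j. \<phi> (star (a i) * a j))"
begin

definition span_fun :: "('b \<times> 'b) list \<Rightarrow> 'b \<Rightarrow> 'b" where
  "span_fun p c = (\<Sum>(a,b)\<leftarrow>p. \<phi> (star c * a) * b)"

definition pairing :: "('b \<times> 'b) list \<Rightarrow> ('b \<Rightarrow> 'b) \<Rightarrow> 'b" where
  "pairing p g = (\<Sum>(a,b)\<leftarrow>p. star b * g a)"

definition span_norm :: "('b \<times> 'b) list \<Rightarrow> real" where
  "span_norm p = sqrt (norm (pairing p (span_fun p)))"

definition right_mul :: "('b \<times> 'b) list \<Rightarrow> 'b \<Rightarrow> ('b \<times> 'b) list" where
  "right_mul p b = map (\<lambda>(a,d). (a, d * b)) p"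

definition left_mul :: "'b \<Rightarrow> ('b \<times> 'b) list \<Rightarrow> ('b \<times> 'b) list" where
  "left_mul x p = map (\<lambda>(a,d). (x * a, d)) p"

lemma span_fun_simps [simp]:
  "span_fun [] c = 0" "span_fun ((a,b) # p) c = \<phi> (star c * a) * b + span_fun p c"
  by (simp_all add: span_fun_def)

lemma pairing_simps [simp]:
  "pairing [] g = 0" "pairing ((a,b) # p) g = star b * g a + pairing p g"
  by (simp_all add: pairing_def)

lemma pairing_zero [simp]: "pairing p (\<lambda>_. 0) = 0"
  by (induction p) auto

lemma span_fun_append: "span_fun (p @ q) c = span_fun p c + span_fun q c"
  by (simp add: span_fun_def)

lemma pairing_append: "pairing (p @ q) g = pairing p g + pairing q g"
  by (simp add: pairing_def)

lemma pairing_add: "pairing p (\<lambda>c. g c + h c) = pairing p g + pairing p h"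
  by (induction p) (auto simp: algebra_simps)

lemma pairing_diff: "pairing p (\<lambda>c. g c - h c) = pairing p g - pairing p h"
  by (induction p) (auto simp: algebra_simps)

lemma pairing_mult: "pairing p (\<lambda>c. g c * b) = pairing p g * b"
  by (induction p) (auto simp: algebra_simps)

lemma pairing_scaleC: "pairing p (\<lambda>c. \<alpha> *\<^sub>C g c) = \<alpha> *\<^sub>C pairing p g"
  by (induction p) (auto simp: mult_scaleC_right scaleC_add_right)

lemma pairing_tendsto: "(\<And>c. (\<lambda>n. f n c) \<longlonglongrightarrow> g c) \<Longrightarrow> (\<lambda>n. pairing p (f n)) \<longlonglongrightarrow> pairing p g"
  by (induction p) (auto intro!: tendsto_intros)

lemma span_fun_right_mul: "span_fun (right_mul p b) c = span_fun p c * b"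
  by (induction p) (auto simp: right_mul_def algebra_simps)

lemma pairing_right_mul: "pairing (right_mul p b) g = star b * pairing p g"
  by (induction p) (auto simp: right_mul_def algebra_simps star_mult)

lemma span_fun_left_mul: "span_fun (left_mul x p) c = span_fun p (star x * c)"
  by (induction p) (auto simp: left_mul_def star_mult mult.assoc)

lemma pairing_left_mul: "pairing (left_mul x p) g = pairing p (\<lambda>c. g (x * c))"
  by (induction p) (auto simp: left_mul_def)

text \<open>Hermiticity of the 2 by 2 matrix belonging to the pair \<open>1\<close>,
  \<open>x\<close>.\<close>

lemma star_\<phi>: "star (\<phi> x) = \<phi> (star x)"
  using form_pos_hermitian[OF pos, of 0 2 1 "\<lambda>i. if i = 0 then 1 else x"] by simp

lemma star_pairing_span_fun: "star (pairing p (span_fun q)) = pairing q (span_fun p)"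
proof (induction p)
  case Nil
  show ?case by simp
next
  case (Cons ab p)
  obtain a b where ab: "ab = (a, b)" by (cases ab)
  have "star (star b * span_fun q a) = pairing q (\<lambda>c. \<phi> (star c * a) * b)"
    by (induction q) (auto simp: star_mult star_add star_\<phi> distrib_right distrib_left mult.assoc)
  moreover have "span_fun (ab # p) = (\<lambda>c. \<phi> (star c * a) * b + span_fun p c)" by (auto simp: ab)
  ultimately show ?case using Cons by (simp add: ab star_add pairing_add)
qed

text \<open>The right coefficients in \<open>p\<close> are the vector at which the form of the
  matrix with entries \<open>\<phi> (star a * a')\<close> is evaluated.\<close>

lemma pairing_span_fun_pos: "cstar_pos (pairing p (span_fun p))"
proof -
  have p: "pairing p g = (\<Sum>i<length p. star (snd (p ! i)) * g (fst (p ! i)))" for g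
    unfolding pairing_def sum_list_sum_nth by (simp add: atLeast0LessThan case_prod_beta)
  have s: "span_fun p c = (\<Sum>i<length p. \<phi> (star c * fst (p ! i)) * snd (p ! i))" for c
    unfolding span_fun_def sum_list_sum_nth by (simp add: atLeast0LessThan case_prod_beta)
  have "pairing p (span_fun p) = mat_form (length p) (\<lambda>i j. \<phi> (star (fst (p ! i)) * fst (p ! j)))
      (\<lambda>i. snd (p ! i)) (\<lambda>i. snd (p ! i))"
    unfolding p s mat_form_def by (simp add: sum_distrib_left mult.assoc)
  then show ?thesis by (simp add: form_posD[OF pos])
qed

lemma span_norm_nonneg [simp]: "span_norm p \<ge> 0" by (simp add: span_norm_def)

lemma span_norm_square: "(span_norm p)\<^sup>2 = norm (pairing p (span_fun p))" by (simp add: span_norm_def)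

lemma norm_pairing_span_fun_le: "norm (pairing p (span_fun q)) \<le> span_norm p * span_norm q"
proof -
  have "(norm (pairing p (span_fun q)))\<^sup>2 \<le> norm (pairing p (span_fun p)) * norm (pairing q (span_fun q))"
  proof (rule cstar_cauchy_schwarz)
    fix b d
    have "span_fun (right_mul p b @ right_mul q d) = (\<lambda>c. span_fun p c * b + span_fun q c * d)"
      by (simp add: span_fun_append span_fun_right_mul fun_eq_iff)
    then show "cstar_pos (star b * pairing p (span_fun p) * b + star b * pairing p (span_fun q) * d
        + star d * star (pairing p (span_fun q)) * b + star d * pairing q (span_fun q) * d)"
      using pairing_span_fun_pos[of "right_mul p b @ right_mul q d"]
      by (simp add: pairing_append pairing_right_mul pairing_add pairing_mult star_pairing_span_fun algebra_simps)
  qed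
  also have "\<dots> = (span_norm p * span_norm q)\<^sup>2" by (simp add: power_mult_distrib span_norm_square)
  finally show ?thesis by (simp add: power2_le_iff_abs_le)
qed

text \<open>Writing the squared norm of \<open>x\<close> as \<open>star x * x + star y * y\<close>,
  the inner squares of \<open>x p\<close> and \<open>y p\<close> add up to the squared norm of
  \<open>x\<close> times that of \<open>p\<close>; dropping the positive term of \<open>y\<close>
  leaves the bound.\<close>

lemma span_norm_left_mul_le: "span_norm (left_mul x p) \<le> norm x * span_norm p"
proof -
  have "cstar_pos ((norm x)\<^sup>2 *\<^sub>R 1 - star x * x)"
    by (rule cstar_pos_norm_diff) (simp_all add: star_mult cstar_identity)
  then obtain y where y: "(norm x)\<^sup>2 *\<^sub>R 1 - star x * x = star y * y" by (auto simp: cstar_pos_def)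
  have e: "pairing (left_mul z p) (span_fun (left_mul z p)) = pairing p (\<lambda>c. span_fun p (star z * z * c))" for z
    by (simp add: pairing_left_mul span_fun_left_mul[abs_def] mult.assoc)
  interpret \<phi>: linear \<phi> by (rule complex_linear_imp_linear[OF lin])
  have "span_fun q ((r *\<^sub>R 1 - u) * c) = r *\<^sub>R span_fun q c - span_fun q (u * c)" for q r u c
    by (induction q) (auto simp: star_mult star_diff \<phi>.diff \<phi>.scale algebra_simps)
  then have "pairing p (\<lambda>c. span_fun p (star y * y * c))
      = pairing p (\<lambda>c. (norm x)\<^sup>2 *\<^sub>R span_fun p c - span_fun p (star x * x * c))"
    unfolding y[symmetric] by simp
  also have "\<dots> = (norm x)\<^sup>2 *\<^sub>R pairing p (span_fun p) - pairing p (\<lambda>c. span_fun p (star x * x * c))"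
    unfolding pairing_diff scaleC_of_real[symmetric] pairing_scaleC ..
  finally have "cstar_pos ((norm x)\<^sup>2 *\<^sub>R pairing p (span_fun p) - pairing (left_mul x p) (span_fun (left_mul x p)))"
    using pairing_span_fun_pos[of "left_mul y p"] unfolding e by simp
  then have "norm (pairing (left_mul x p) (span_fun (left_mul x p))) \<le> norm ((norm x)\<^sup>2 *\<^sub>R pairing p (span_fun p))"
    by (intro norm_mono_cstar_pos pairing_span_fun_pos)
  then have "(span_norm (left_mul x p))\<^sup>2 \<le> (norm x * span_norm p)\<^sup>2"
    by (simp add: span_norm_square power_mult_distrib)
  then show ?thesis by (simp add: power2_le_iff_abs_le)
qed

section \<open>Dual norm and completion\<close>

text \<open>A bound on the norm of \<open>g\<close> as a functional on the span. It makes sense for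
  every function, so limits can be estimated before they are known to be vectors.\<close>

definition bounded_by :: "real \<Rightarrow> ('b \<Rightarrow> 'b) \<Rightarrow> bool" where
  "bounded_by C g \<longleftrightarrow> (\<forall>q. norm (pairing q g) \<le> C * span_norm q)"

lemma bounded_by_span_fun: "bounded_by (span_norm p) (span_fun p)"
  using norm_pairing_span_fun_le by (simp add: bounded_by_def mult.commute)

lemma bounded_by_add: "bounded_by C g \<Longrightarrow> bounded_by D h \<Longrightarrow> bounded_by (C + D) (\<lambda>c. g c + h c)"
  unfolding bounded_by_def pairing_add distrib_right by (blast intro: norm_triangle_mono)

lemma bounded_by_diff: "bounded_by C g \<Longrightarrow> bounded_by D h \<Longrightarrow> bounded_by (C + D) (\<lambda>c. g c - h c)"
  unfolding bounded_by_def pairing_diff distrib_right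
  by (blast intro: order.trans[OF norm_triangle_ineq4] add_mono)

lemma bounded_by_mult: "bounded_by C g \<Longrightarrow> bounded_by (C * norm b) (\<lambda>c. g c * b)"
  unfolding bounded_by_def pairing_mult
proof
  fix q assume "\<forall>q. norm (pairing q g) \<le> C * span_norm q"
  then have "norm (pairing q g) * norm b \<le> C * span_norm q * norm b" by (intro mult_right_mono) auto
  then show "norm (pairing q g * b) \<le> C * norm b * span_norm q"
    using norm_mult_ineq[of "pairing q g" b] by (simp add: mult.assoc mult.commute mult.left_commute)
qed

lemma bounded_by_left:
  assumes "bounded_by C g" "C \<ge> 0" shows "bounded_by (C * norm x) (\<lambda>c. g (star x * c))"
  unfolding bounded_by_def
proof
  fix q
  have "norm (pairing q (\<lambda>c. g (star x * c))) \<le> C * span_norm (left_mul (star x) q)"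
    using assms(1) by (simp add: bounded_by_def pairing_left_mul[symmetric])
  also have "\<dots> \<le> C * (norm x * span_norm q)"
    using span_norm_left_mul_le[of "star x" q] assms(2) by (intro mult_left_mono) auto
  finally show "norm (pairing q (\<lambda>c. g (star x * c))) \<le> C * norm x * span_norm q" by (simp add: mult.assoc)
qed

lemma bounded_by_mono: "bounded_by C g \<Longrightarrow> C \<le> D \<Longrightarrow> bounded_by D g"
  unfolding bounded_by_def by (meson mult_right_mono order.trans span_norm_nonneg)

lemma bounded_by_eval: "bounded_by C g \<Longrightarrow> norm (g c) \<le> C * span_norm [(c, 1)]"
  unfolding bounded_by_def by (drule spec[of _ "[(c, 1)]"]) simp

text \<open>Testing the functional on \<open>p\<close> itself shows that the dual norm is no smaller
  than the norm on the span.\<close>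

lemma span_norm_le: "bounded_by C (span_fun p) \<Longrightarrow> C \<ge> 0 \<Longrightarrow> span_norm p \<le> C"
  unfolding bounded_by_def using span_norm_nonneg[of p]
  by (drule_tac spec[of _ p], cases "span_norm p = 0")
     (simp_all add: span_norm_square[symmetric] power2_eq_square)

text \<open>The rate \<open>\<epsilon>\<close> is kept as data so that each operation on vectors
  transforms it by an explicit formula.\<close>

definition approx :: "('b \<Rightarrow> 'b) \<Rightarrow> (nat \<Rightarrow> ('b \<times> 'b) list) \<Rightarrow> (nat \<Rightarrow> real) \<Rightarrow> bool" where
  "approx g p \<epsilon> \<longleftrightarrow> \<epsilon> \<longlonglongrightarrow> 0 \<and> (\<forall>n. \<epsilon> n \<ge> 0 \<and> bounded_by (\<epsilon> n) (\<lambda>c. g c - span_fun (p n) c))"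

text \<open>The completion of the span. Lists that differ by a null vector have the same
  \<open>span_fun\<close>, so the null space is already divided out.\<close>

definition vectors :: "('b \<Rightarrow> 'b) set" where
  "vectors = {g. \<exists>p \<epsilon>. approx g p \<epsilon>}"

lemma approx_span_fun: "approx (span_fun p) (\<lambda>_. p) (\<lambda>_. 0)"
proof -
  have "pairing q (\<lambda>c. 0) = 0" for q by (induction q) auto
  then show ?thesis by (simp add: approx_def bounded_by_def)
qed

lemma approx_add:
  assumes "approx g p \<epsilon>" "approx h q \<delta>"
  shows "approx (\<lambda>c. g c + h c) (\<lambda>n. p n @ q n) (\<lambda>n. \<epsilon> n + \<delta> n)"
proof -
  have "bounded_by (\<epsilon> n + \<delta> n) (\<lambda>c. (g c - span_fun (p n) c) + (h c - span_fun (q n) c))" for n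
    using assms by (intro bounded_by_add) (auto simp: approx_def)
  then show ?thesis
    using assms tendsto_add[of \<epsilon> 0 sequentially \<delta> 0] by (simp add: approx_def span_fun_append algebra_simps)
qed

lemma approx_mult:
  assumes "approx g p \<epsilon>"
  shows "approx (\<lambda>c. g c * b) (\<lambda>n. right_mul (p n) b) (\<lambda>n. \<epsilon> n * norm b)"
proof -
  have "bounded_by (\<epsilon> n * norm b) (\<lambda>c. (g c - span_fun (p n) c) * b)" for n
    using assms by (intro bounded_by_mult) (auto simp: approx_def)
  then show ?thesis
    using assms tendsto_mult_left_zero[of \<epsilon>] by (simp add: approx_def span_fun_right_mul left_diff_distrib)
qed

lemma approx_left:
  assumes "approx g p \<epsilon>"
  shows "approx (\<lambda>c. g (star x * c)) (\<lambda>n. left_mul x (p n)) (\<lambda>n. \<epsilon> n * norm x)"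
proof -
  have "bounded_by (\<epsilon> n * norm x) (\<lambda>c. g (star x * c) - span_fun (p n) (star x * c))" for n
    using assms by (intro bounded_by_left[of _ "\<lambda>c. g c - span_fun (p n) c"]) (auto simp: approx_def)
  then show ?thesis
    using assms tendsto_mult_left_zero[of \<epsilon>] by (simp add: approx_def span_fun_left_mul)
qed

lemma approx_tendsto: 
  assumes "approx g p \<epsilon>" shows "(\<lambda>n. pairing q (span_fun (p n))) \<longlonglongrightarrow> pairing q g"
proof -
  have "(\<lambda>n. pairing q (span_fun (p n)) - pairing q g) \<longlonglongrightarrow> 0"
  proof (rule Lim_null_comparison)
    show "(\<lambda>n. \<epsilon> n * span_norm q) \<longlonglongrightarrow> 0"
      using assms by (intro tendsto_mult_left_zero) (simp add: approx_def)
    show "\<forall>\<^sub>F n in sequentially. norm (pairing q (span_fun (p n)) - pairing q g) \<le> \<epsilon> n * span_norm q"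
      using assms by (auto simp: approx_def bounded_by_def pairing_diff norm_minus_commute)
  qed
  then show ?thesis by (simp add: LIM_zero_iff)
qed

lemma approx_eval: "approx g p \<epsilon> \<Longrightarrow> (\<lambda>n. span_fun (p n) c) \<longlonglongrightarrow> g c"
  using approx_tendsto[of g p \<epsilon> "[(c, 1)]"] by simp

lemma vectors_bounded:
  assumes "g \<in> vectors" obtains C where "C \<ge> 0" "bounded_by C g"
proof -
  obtain p \<epsilon> where a: "approx g p \<epsilon>" using assms by (auto simp: vectors_def)
  have "bounded_by (\<epsilon> 0 + span_norm (p 0)) (\<lambda>c. (g c - span_fun (p 0) c) + span_fun (p 0) c)"
    using a by (intro bounded_by_add bounded_by_span_fun) (auto simp: approx_def)
  moreover have "\<epsilon> 0 + span_norm (p 0) \<ge> 0" using a by (auto simp: approx_def)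
  ultimately show thesis using that by simp
qed

text \<open>The list \<open>?r\<close> represents the difference of the two approximants. For equal
  sequences this gives the Cauchy property, for different ones independence of the choice.\<close>

lemma norm_pairing_diff_le:
  assumes p: "approx g p \<epsilon>" and p': "approx g p' \<epsilon>'" and h: "bounded_by C h" "C \<ge> 0"
  shows "norm (pairing (p m) h - pairing (p' n) h) \<le> C * (\<epsilon> m + \<epsilon>' n)"
proof -
  let ?r = "p m @ right_mul (p' n) (- 1)"
  have "bounded_by (\<epsilon>' n + \<epsilon> m) (\<lambda>c. (g c - span_fun (p' n) c) - (g c - span_fun (p m) c))"
    using p p' by (intro bounded_by_diff) (auto simp: approx_def)
  also have "(\<lambda>c. (g c - span_fun (p' n) c) - (g c - span_fun (p m) c)) = span_fun ?r"
    by (auto simp: span_fun_append span_fun_right_mul)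
  finally have "span_norm ?r \<le> \<epsilon>' n + \<epsilon> m"
    by (rule span_norm_le) (use p p' in \<open>auto simp: approx_def\<close>)
  then have "C * span_norm ?r \<le> C * (\<epsilon> m + \<epsilon>' n)" using h by (intro mult_left_mono) auto
  moreover have "norm (pairing ?r h) \<le> C * span_norm ?r" using h by (simp add: bounded_by_def)
  moreover have "pairing ?r h = pairing (p m) h - pairing (p' n) h"
    by (simp add: pairing_append pairing_right_mul)
  ultimately show ?thesis by simp
qed

section \<open>Inner product on the completion\<close>

definition inner_prod :: "('b \<Rightarrow> 'b) \<Rightarrow> ('b \<Rightarrow> 'b) \<Rightarrow> 'b" where
  "inner_prod g h = lim (\<lambda>n. pairing ((SOME p. \<exists>\<epsilon>. approx g p \<epsilon>) n) h)"

lemma pairing_tendsto_inner_prod: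
  assumes p: "approx g p \<epsilon>" and h: "h \<in> vectors"
  shows "(\<lambda>n. pairing (p n) h) \<longlonglongrightarrow> inner_prod g h"
proof -
  obtain C where C: "C \<ge> 0" "bounded_by C h" using h by (rule vectors_bounded)
  let ?p = "SOME p. \<exists>\<epsilon>. approx g p \<epsilon>"
  obtain \<delta> where q: "approx g ?p \<delta>" using someI_ex[of "\<lambda>p. \<exists>\<epsilon>. approx g p \<epsilon>"] p by blast
  have "Cauchy (\<lambda>n. pairing (?p n) h)"
  proof (rule metric_CauchyI)
    fix e :: real assume "e > 0"
    then have e: "e / (C + 1) / 2 > 0" using C by simp
    obtain N where N: "\<And>n. n \<ge> N \<Longrightarrow> \<bar>\<delta> n\<bar> < e / (C + 1) / 2"
      using LIMSEQ_D[OF _ e, of \<delta> 0] q by (auto simp: approx_def)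
    show "\<exists>M. \<forall>m\<ge>M. \<forall>n\<ge>M. dist (pairing (?p m) h) (pairing (?p n) h) < e"
    proof (intro exI allI impI)
      fix m n assume mn: "m \<ge> N" "n \<ge> N"
      have "dist (pairing (?p m) h) (pairing (?p n) h) \<le> C * (\<delta> m + \<delta> n)"
        unfolding dist_norm by (rule norm_pairing_diff_le[OF q q C(2,1)])
      also have "\<dots> \<le> (C + 1) * (\<delta> m + \<delta> n)" using C q by (intro mult_right_mono) (auto simp: approx_def)
      also have "\<dots> < (C + 1) * (e / (C + 1) / 2 + e / (C + 1) / 2)"
        using N[OF mn(1)] N[OF mn(2)] C by (intro mult_strict_left_mono) auto
      also have "\<dots> = (C + 1) * (e / (C + 1))" by (simp only: field_sum_of_halves)
      also have "\<dots> = e" using C by simp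
      finally show "dist (pairing (?p m) h) (pairing (?p n) h) < e" .
    qed
  qed
  then have l: "(\<lambda>n. pairing (?p n) h) \<longlonglongrightarrow> inner_prod g h"
    unfolding inner_prod_def by (simp add: Cauchy_convergent_iff convergent_LIMSEQ_iff)
  have "(\<lambda>n. pairing (p n) h - pairing (?p n) h) \<longlonglongrightarrow> 0"
  proof (rule Lim_null_comparison)
    have "(\<lambda>n. C * (\<epsilon> n + \<delta> n)) \<longlonglongrightarrow> C * (0 + 0)" using p q by (intro tendsto_intros) (auto simp: approx_def)
    then show "(\<lambda>n. C * (\<epsilon> n + \<delta> n)) \<longlonglongrightarrow> 0" by simp
  qed (simp add: norm_pairing_diff_le[OF p q C(2,1)])
  from tendsto_add[OF this l] show ?thesis by simp
qed

text \<open>Approximating both arguments by the span transfers symmetry and positivity to the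
  completion.\<close>

lemma pairing_span_fun_tendsto_inner_prod:
  assumes p: "approx g p \<epsilon>" and q: "approx h q \<delta>"
  shows "(\<lambda>n. pairing (p n) (span_fun (q n))) \<longlonglongrightarrow> inner_prod g h"
proof -
  obtain C where C: "C \<ge> 0" "bounded_by C g" using vectors_bounded[of g] p by (auto simp: vectors_def)
  have le: "span_norm (p n) \<le> C + \<epsilon> n" for n
  proof (rule span_norm_le)
    have "bounded_by (C + \<epsilon> n) (\<lambda>c. g c - (g c - span_fun (p n) c))"
      using p C by (intro bounded_by_diff) (auto simp: approx_def)
    then show "bounded_by (C + \<epsilon> n) (span_fun (p n))" by simp
    show "C + \<epsilon> n \<ge> 0" using C p by (auto simp: approx_def)
  qed
  have "(\<lambda>n. pairing (p n) h - pairing (p n) (span_fun (q n))) \<longlonglongrightarrow> 0"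
  proof (rule Lim_null_comparison)
    have "(\<lambda>n. \<delta> n * (C + \<epsilon> n)) \<longlonglongrightarrow> 0 * (C + 0)" using p q by (intro tendsto_intros) (auto simp: approx_def)
    then show "(\<lambda>n. \<delta> n * (C + \<epsilon> n)) \<longlonglongrightarrow> 0" by simp
    have "norm (pairing (p n) h - pairing (p n) (span_fun (q n))) \<le> \<delta> n * (C + \<epsilon> n)" for n
    proof -
      have "norm (pairing (p n) h - pairing (p n) (span_fun (q n))) \<le> \<delta> n * span_norm (p n)"
        using q by (simp add: approx_def bounded_by_def pairing_diff[symmetric])
      also have "\<dots> \<le> \<delta> n * (C + \<epsilon> n)" using q le by (intro mult_left_mono) (auto simp: approx_def)
      finally show ?thesis .
    qed
    then show "\<forall>\<^sub>F n in sequentially. norm (pairing (p n) h - pairing (p n) (span_fun (q n))) \<le> \<delta> n * (C + \<epsilon> n)"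
      by simp
  qed
  moreover have "(\<lambda>n. pairing (p n) h) \<longlonglongrightarrow> inner_prod g h"
    using q by (intro pairing_tendsto_inner_prod[OF p]) (auto simp: vectors_def)
  ultimately show ?thesis using tendsto_diff by fastforce
qed

definition vec_norm :: "('b \<Rightarrow> 'b) \<Rightarrow> real" where
  "vec_norm g = sqrt (norm (inner_prod g g))"

lemma vec_norm_nonneg [simp]: "vec_norm g \<ge> 0" by (simp add: vec_norm_def)

lemma span_norm_tendsto: "approx g p \<epsilon> \<Longrightarrow> (\<lambda>n. span_norm (p n)) \<longlonglongrightarrow> vec_norm g"
  unfolding span_norm_def vec_norm_def
  by (intro tendsto_real_sqrt tendsto_norm pairing_span_fun_tendsto_inner_prod)

text \<open>Together with \<open>vec_norm_le\<close>, this identifies the norm of the inner product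
  with the least bound as a functional.\<close>

lemma bounded_by_vec_norm:
  assumes "g \<in> vectors" shows "bounded_by (vec_norm g) g"
  unfolding bounded_by_def
proof
  fix q
  obtain p \<epsilon> where p: "approx g p \<epsilon>" using assms by (auto simp: vectors_def)
  show "norm (pairing q g) \<le> vec_norm g * span_norm q"
  proof (rule LIMSEQ_le)
    show "(\<lambda>n. norm (pairing q (span_fun (p n)))) \<longlonglongrightarrow> norm (pairing q g)"
      by (intro tendsto_norm approx_tendsto[OF p])
    show "(\<lambda>n. span_norm (p n) * span_norm q) \<longlonglongrightarrow> vec_norm g * span_norm q"
      by (intro tendsto_intros span_norm_tendsto[OF p])
    show "\<exists>N. \<forall>n\<ge>N. norm (pairing q (span_fun (p n))) \<le> span_norm (p n) * span_norm q"
      using norm_pairing_span_fun_le by (simp add: mult.commute)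
  qed
qed

lemma vec_norm_le:
  assumes g: "g \<in> vectors" "bounded_by C g" "C \<ge> 0" shows "vec_norm g \<le> C"
proof -
  obtain p \<epsilon> where p: "approx g p \<epsilon>" using g by (auto simp: vectors_def)
  have "norm (inner_prod g g) \<le> C * vec_norm g"
  proof (rule LIMSEQ_le)
    show "(\<lambda>n. norm (pairing (p n) g)) \<longlonglongrightarrow> norm (inner_prod g g)"
      by (intro tendsto_norm pairing_tendsto_inner_prod[OF p] g)
    show "(\<lambda>n. C * span_norm (p n)) \<longlonglongrightarrow> C * vec_norm g"
      by (intro tendsto_intros span_norm_tendsto[OF p])
    show "\<exists>N. \<forall>n\<ge>N. norm (pairing (p n) g) \<le> C * span_norm (p n)"
      using g by (simp add: bounded_by_def)
  qed
  moreover have "norm (inner_prod g g) = vec_norm g * vec_norm g" by (simp add: vec_norm_def)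
  ultimately show ?thesis using g(3) vec_norm_nonneg[of g] by (cases "vec_norm g = 0") simp_all
qed

lemma vectors_add: "g \<in> vectors \<Longrightarrow> h \<in> vectors \<Longrightarrow> (\<lambda>c. g c + h c) \<in> vectors"
  unfolding vectors_def using approx_add by blast

lemma vectors_mult: "g \<in> vectors \<Longrightarrow> (\<lambda>c. g c * b) \<in> vectors"
  unfolding vectors_def using approx_mult by blast

lemma vectors_left: "g \<in> vectors \<Longrightarrow> (\<lambda>c. g (star x * c)) \<in> vectors"
  unfolding vectors_def using approx_left by blast

lemma vectors_span_fun: "span_fun p \<in> vectors"
  unfolding vectors_def using approx_span_fun by blast

lemma vectors_zero: "(\<lambda>_. 0) \<in> vectors"
proof -
  have "span_fun [] = (\<lambda>_. 0)" by auto
  then show ?thesis using vectors_span_fun by metis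
qed

lemma vectors_scaleC: "g \<in> vectors \<Longrightarrow> (\<lambda>c. \<alpha> *\<^sub>C g c) \<in> vectors"
  using vectors_mult[of g "\<alpha> *\<^sub>C 1"] by (simp add: mult_scaleC_right)

lemma vectors_uminus: "g \<in> vectors \<Longrightarrow> (\<lambda>c. - g c) \<in> vectors"
  using vectors_mult[of g "- 1"] by simp

lemma vectors_diff: "g \<in> vectors \<Longrightarrow> h \<in> vectors \<Longrightarrow> (\<lambda>c. g c - h c) \<in> vectors"
  using vectors_add[OF _ vectors_uminus, of g h] by simp

text \<open>Passes from the span to pointwise limits; linearity of the left action in the algebra
  element rests on it.\<close>

lemma vectors_conj_linear:
  assumes "g \<in> vectors" shows "g (x + y) = g x + g y" "g (\<alpha> *\<^sub>C x) = cnj \<alpha> *\<^sub>C g x"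
proof -
  obtain p \<epsilon> where p: "approx g p \<epsilon>" using assms by (auto simp: vectors_def)
  have "span_fun q (x + y) = span_fun q x + span_fun q y" for q
    by (induction q) (auto simp: star_add distrib_right complex_linear_add[OF lin])
  then have "(\<lambda>n. span_fun (p n) (x + y)) \<longlonglongrightarrow> g x + g y"
    using tendsto_add[OF approx_eval[OF p] approx_eval[OF p]] by simp
  then show "g (x + y) = g x + g y" using approx_eval[OF p] LIMSEQ_unique by blast
  have "span_fun q (\<alpha> *\<^sub>C x) = cnj \<alpha> *\<^sub>C span_fun q x" for q
    by (induction q) (auto simp: star_scaleC mult_scaleC_left complex_linear_scaleC[OF lin] scaleC_add_right)
  then have "(\<lambda>n. span_fun (p n) (\<alpha> *\<^sub>C x)) \<longlonglongrightarrow> cnj \<alpha> *\<^sub>C g x"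
    using bounded_linear.tendsto[OF bounded_linear_scaleC approx_eval[OF p]] by simp
  then show "g (\<alpha> *\<^sub>C x) = cnj \<alpha> *\<^sub>C g x" using approx_eval[OF p] LIMSEQ_unique by blast
qed

lemma vectorsI:
  assumes "\<And>e. e > 0 \<Longrightarrow> \<exists>p. bounded_by e (\<lambda>c. g c - span_fun p c)"
  shows "g \<in> vectors"
proof -
  have "\<exists>p. bounded_by (inverse (real (Suc n))) (\<lambda>c. g c - span_fun p c)" for n by (rule assms) simp
  then obtain p where "\<And>n. bounded_by (inverse (real (Suc n))) (\<lambda>c. g c - span_fun (p n) c)" by metis
  then have "approx g p (\<lambda>n. inverse (real (Suc n)))"
    unfolding approx_def using LIMSEQ_inverse_real_of_nat by (simp add: del: of_nat_Suc)
  then show ?thesis by (auto simp: vectors_def)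
qed

lemma vectors_close:
  assumes "g \<in> vectors" "e > 0" obtains p where "bounded_by e (\<lambda>c. g c - span_fun p c)"
proof -
  obtain p \<epsilon> where p: "approx g p \<epsilon>" using assms by (auto simp: vectors_def)
  then obtain N where N: "\<bar>\<epsilon> N\<bar> < e" using LIMSEQ_D[of \<epsilon> 0 e] assms(2) by (auto simp: approx_def)
  have "bounded_by e (\<lambda>c. g c - span_fun (p N) c)"
    by (rule bounded_by_mono[of "\<epsilon> N"]) (use p N in \<open>auto simp: approx_def\<close>)
  then show thesis by (rule that)
qed

text \<open>Evaluation at \<open>c\<close> is bounded, so a pointwise limit exists; bounds on
  functionals persist under pointwise limits, and an approximation of some \<open>X N\<close> by the
  span also approximates the limit.\<close>

lemma vectors_complete:
  assumes X: "\<And>n. X n \<in> vectors"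
    and Cauchy: "\<And>e. e > 0 \<Longrightarrow> \<exists>N. \<forall>m\<ge>N. \<forall>n\<ge>N. vec_norm (\<lambda>c. X m c - X n c) < e"
  shows "\<exists>x\<in>vectors. (\<lambda>n. vec_norm (\<lambda>c. X n c - x c)) \<longlonglongrightarrow> 0"
proof -
  have b: "bounded_by (vec_norm (\<lambda>c. X m c - X n c)) (\<lambda>c. X m c - X n c)" for m n
    by (intro bounded_by_vec_norm vectors_diff X)
  have "Cauchy (\<lambda>n. X n c)" for c
  proof (rule metric_CauchyI)
    fix e :: real assume "e > 0"
    let ?M = "span_norm [(c, 1)]"
    \<comment> \<open>The added 1 avoids dividing by a vanishing \<open>?M\<close>.\<close>
    have e': "e / (?M + 1) > 0" using \<open>e > 0\<close> by (simp add: add_nonneg_pos)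
    obtain N where N: "\<forall>m\<ge>N. \<forall>n\<ge>N. vec_norm (\<lambda>c. X m c - X n c) < e / (?M + 1)"
      using Cauchy[OF e'] by blast
    show "\<exists>M. \<forall>m\<ge>M. \<forall>n\<ge>M. dist (X m c) (X n c) < e"
    proof (intro exI allI impI)
      fix m n assume "m \<ge> N" "n \<ge> N"
      then have v: "vec_norm (\<lambda>c. X m c - X n c) < e / (?M + 1)" using N by blast
      have "dist (X m c) (X n c) \<le> vec_norm (\<lambda>c. X m c - X n c) * ?M"
        unfolding dist_norm using bounded_by_eval[OF b] .
      also have "\<dots> \<le> vec_norm (\<lambda>c. X m c - X n c) * (?M + 1)" by (intro mult_left_mono) auto
      also have "\<dots> < e" using v by (simp add: pos_less_divide_eq add_nonneg_pos)
      finally show "dist (X m c) (X n c) < e" .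
    qed
  qed
  then have "\<exists>l. (\<lambda>n. X n c) \<longlonglongrightarrow> l" for c
    by (simp add: Cauchy_convergent_iff convergent_def)
  then obtain x where x: "\<And>c. (\<lambda>n. X n c) \<longlonglongrightarrow> x c" by metis
  have close: "\<exists>N. \<forall>m\<ge>N. bounded_by e (\<lambda>c. X m c - x c)" if e: "e > 0" for e
  proof -
    obtain N where N: "\<forall>m\<ge>N. \<forall>n\<ge>N. vec_norm (\<lambda>c. X m c - X n c) < e" using Cauchy[OF e] by blast
    have "bounded_by e (\<lambda>c. X m c - x c)" if m: "m \<ge> N" for m
      unfolding bounded_by_def
    proof
      fix q
      have "(\<lambda>n. pairing q (\<lambda>c. X m c - X n c)) \<longlonglongrightarrow> pairing q (\<lambda>c. X m c - x c)"
        by (intro pairing_tendsto tendsto_intros x)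
      from tendsto_norm[OF this] show "norm (pairing q (\<lambda>c. X m c - x c)) \<le> e * span_norm q"
      proof (rule LIMSEQ_le_const2, intro exI allI impI)
        fix n assume n: "n \<ge> N"
        have "bounded_by e (\<lambda>c. X m c - X n c)"
          by (rule bounded_by_mono[OF b]) (use N m n in \<open>auto intro: less_imp_le\<close>)
        then show "norm (pairing q (\<lambda>c. X m c - X n c)) \<le> e * span_norm q" by (simp add: bounded_by_def)
      qed
    qed
    then show ?thesis by blast
  qed
  have xv: "x \<in> vectors"
  proof (rule vectorsI)
    fix e :: real assume e: "e > 0"
    then have e2: "e / 2 > 0" by simp
    obtain N where N: "bounded_by (e/2) (\<lambda>c. X N c - x c)" using close[OF e2] by blast
    obtain p where p: "bounded_by (e/2) (\<lambda>c. X N c - span_fun p c)" using X e2 by (rule vectors_close)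
    from bounded_by_diff[OF p N] show "\<exists>p. bounded_by e (\<lambda>c. x c - span_fun p c)" by auto
  qed
  have "(\<lambda>n. vec_norm (\<lambda>c. X n c - x c)) \<longlonglongrightarrow> 0"
  proof (rule LIMSEQ_I)
    fix e :: real assume e: "e > 0"
    obtain N where N: "\<And>m. m \<ge> N \<Longrightarrow> bounded_by (e/2) (\<lambda>c. X m c - x c)" using close[of "e/2"] e by auto
    show "\<exists>N. \<forall>n\<ge>N. norm (vec_norm (\<lambda>c. X n c - x c) - 0) < e"
    proof (intro exI allI impI)
      fix n assume "n \<ge> N"
      then have "vec_norm (\<lambda>c. X n c - x c) \<le> e/2" using e by (intro vec_norm_le vectors_diff X xv N) auto
      then show "norm (vec_norm (\<lambda>c. X n c - x c) - 0) < e" using e by simp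
    qed
  qed
  with xv show ?thesis by blast
qed

section \<open>The GNS correspondence\<close>

text \<open>The left action is dictated by moving \<open>x\<close> to the other side of the pairing
  with \<open>c \<zeta>\<close>, where it becomes \<open>star x * c\<close>.\<close>

definition gns :: "('b, 'b \<Rightarrow> 'b) bimodule" where
  "gns = \<lparr>carrier = vectors, mult = undefined, one = undefined, zero = (\<lambda>_. 0), add = (\<lambda>g h c. g c + h c),
     csmult = (\<lambda>\<alpha> g c. \<alpha> *\<^sub>C g c), ract = (\<lambda>g b c. g c * b), lact = (\<lambda>x g c. g (star x * c)), ip = inner_prod\<rparr>"

lemma gns_sel [simp]:
  "carrier gns = vectors" "zero gns = (\<lambda>_. 0)" "add gns = (\<lambda>g h c. g c + h c)"
  "csmult gns = (\<lambda>\<alpha> g c. \<alpha> *\<^sub>C g c)" "ract gns = (\<lambda>g b c. g c * b)"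
  "lact gns = (\<lambda>x g c. g (star x * c))" "ip gns = inner_prod"
  by (simp_all add: gns_def)

lemma gns_abelian_group: "abelian_group gns"
proof (rule abelian_groupI)
  fix x assume "x \<in> carrier gns"
  then show "\<exists>y\<in>carrier gns. y \<oplus>\<^bsub>gns\<^esub> x = \<zero>\<^bsub>gns\<^esub>" by (intro bexI[of _ "\<lambda>c. - x c"]) (auto intro: vectors_uminus)
qed (auto simp: vectors_add vectors_zero add.assoc add.commute)

lemma gns_minus:
  assumes "g \<in> vectors" "h \<in> vectors" shows "g \<ominus>\<^bsub>gns\<^esub> h = (\<lambda>c. g c - h c)"
proof -
  have "\<ominus>\<^bsub>gns\<^esub> h = (\<lambda>c. - h c)"
    by (rule abelian_group.minus_equality[OF gns_abelian_group]) (use assms in \<open>auto intro: vectors_uminus\<close>)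
  then show ?thesis by (simp add: a_minus_def)
qed

lemma inner_prod_eqI:
  assumes "approx g p \<epsilon>" "h \<in> vectors" "(\<lambda>n. pairing (p n) h) \<longlonglongrightarrow> l"
  shows "inner_prod g h = l"
  using pairing_tendsto_inner_prod[OF assms(1,2)] assms(3) by (rule LIMSEQ_unique)

lemma vectorsE:
  assumes "g \<in> vectors" obtains p \<epsilon> where "approx g p \<epsilon>"
  using assms by (auto simp: vectors_def)

lemma gns_correspondence: "correspondence gns"
proof -
  interpret abelian_group gns by (rule gns_abelian_group)
  show ?thesis
  proof (unfold_locales, unfold gns_sel)
    fix x y z :: "'b \<Rightarrow> 'b" and a a' :: complex and b b' :: 'b
    show "(\<lambda>c. a *\<^sub>C x c) \<in> vectors" if "x \<in> vectors" using that by (rule vectors_scaleC)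
    show "(\<lambda>c. (a + a') *\<^sub>C x c) = (\<lambda>c. a *\<^sub>C x c + a' *\<^sub>C x c)" by (simp add: scaleC_add_left)
    show "(\<lambda>c. a *\<^sub>C (x c + y c)) = (\<lambda>c. a *\<^sub>C x c + a *\<^sub>C y c)" by (simp add: scaleC_add_right)
    show "(\<lambda>c. a *\<^sub>C a' *\<^sub>C x c) = (\<lambda>c. (a * a') *\<^sub>C x c)" by (simp add: scaleC_scaleC)
    show "(\<lambda>c. 1 *\<^sub>C x c) = x" by simp
    show "(\<lambda>c. x c * b) \<in> vectors" if "x \<in> vectors" using that by (rule vectors_mult)
    show "(\<lambda>c. (x c + y c) * b) = (\<lambda>c. x c * b + y c * b)" by (simp add: distrib_right)
    show "(\<lambda>c. x c * (b + b')) = (\<lambda>c. x c * b + x c * b')" by (simp add: distrib_left)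
    show "(\<lambda>c. x c * (b * b')) = (\<lambda>c. x c * b * b')" by (simp add: mult.assoc)
    show "(\<lambda>c. x c * 1) = x" by simp
    show "(\<lambda>c. a *\<^sub>C x c * b) = (\<lambda>c. a *\<^sub>C (x c * b))" by (simp add: mult_scaleC_left)
    show "(\<lambda>c. x c * a *\<^sub>C b) = (\<lambda>c. a *\<^sub>C (x c * b))" by (simp add: mult_scaleC_right)
    show "inner_prod x (\<lambda>c. y c + z c) = inner_prod x y + inner_prod x z"
      if xyz: "x \<in> vectors" "y \<in> vectors" "z \<in> vectors"
    proof -
      obtain p \<epsilon> where p: "approx x p \<epsilon>" using xyz(1) by (rule vectorsE)
      show ?thesis unfolding inner_prod_eqI[OF p vectors_add[OF xyz(2,3)],
          unfolded pairing_add, OF tendsto_add[OF pairing_tendsto_inner_prod[OF p xyz(2)] pairing_tendsto_inner_prod[OF p xyz(3)]]] ..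
    qed
    show "inner_prod x (\<lambda>c. a *\<^sub>C y c) = a *\<^sub>C inner_prod x y" if xy: "x \<in> vectors" "y \<in> vectors"
    proof -
      obtain p \<epsilon> where p: "approx x p \<epsilon>" using xy(1) by (rule vectorsE)
      show ?thesis
        by (rule inner_prod_eqI[OF p vectors_scaleC[OF xy(2)]], unfold pairing_scaleC)
           (intro bounded_linear.tendsto[OF bounded_linear_scaleC] pairing_tendsto_inner_prod[OF p xy(2)])
    qed
    show "inner_prod x (\<lambda>c. y c * b) = inner_prod x y * b" if xy: "x \<in> vectors" "y \<in> vectors"
    proof -
      obtain p \<epsilon> where p: "approx x p \<epsilon>" using xy(1) by (rule vectorsE)
      show ?thesis
        by (rule inner_prod_eqI[OF p vectors_mult[OF xy(2)]], unfold pairing_mult)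
           (intro tendsto_intros pairing_tendsto_inner_prod[OF p xy(2)])
    qed
    show "star (inner_prod x y) = inner_prod y x" if xy: "x \<in> vectors" "y \<in> vectors"
    proof -
      obtain p \<epsilon> where p: "approx x p \<epsilon>" using xy(1) by (rule vectorsE)
      obtain q \<delta> where q: "approx y q \<delta>" using xy(2) by (rule vectorsE)
      show ?thesis
        using tendsto_star[OF pairing_span_fun_tendsto_inner_prod[OF p q]]
          pairing_span_fun_tendsto_inner_prod[OF q p]
        unfolding star_pairing_span_fun by (rule LIMSEQ_unique)
    qed
    show "cstar_pos (inner_prod x x)" if x: "x \<in> vectors"
    proof -
      obtain p \<epsilon> where p: "approx x p \<epsilon>" using x by (rule vectorsE)
      show ?thesis
        by (rule cstar_pos_limit[OF pairing_span_fun_tendsto_inner_prod[OF p p]])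
           (simp_all add: pairing_span_fun_pos)
    qed
    show "x = (\<lambda>_. 0)" if x: "x \<in> vectors" "inner_prod x x = 0"
    proof
      show "x c = 0" for c
        using bounded_by_eval[OF bounded_by_vec_norm[OF x(1)], of c] x(2) by (simp add: vec_norm_def)
    qed
    show "\<exists>x\<in>vectors. (\<lambda>n. ip_norm gns (X n \<ominus>\<^bsub>gns\<^esub> x)) \<longlonglongrightarrow> 0"
      if X: "\<And>n. X n \<in> vectors"
        and C: "\<And>e. e > 0 \<Longrightarrow> \<exists>N. \<forall>m\<ge>N. \<forall>n\<ge>N. ip_norm gns (X m \<ominus>\<^bsub>gns\<^esub> X n) < e" for X :: "nat \<Rightarrow> 'b \<Rightarrow> 'b"
    proof -
      have v: "ip_norm gns g = vec_norm g" for g by (simp add: ip_norm_def vec_norm_def)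
      have "\<exists>x\<in>vectors. (\<lambda>n. vec_norm (\<lambda>c. X n c - x c)) \<longlonglongrightarrow> 0"
        by (rule vectors_complete[of X, OF X C[unfolded v gns_minus[OF X X]]])
      then obtain x where x: "x \<in> vectors" "(\<lambda>n. vec_norm (\<lambda>c. X n c - x c)) \<longlonglongrightarrow> 0" ..
      then show ?thesis unfolding v by (intro bexI[of _ x]) (simp_all add: gns_minus X)
    qed
    show "(\<lambda>c. x (star b * c)) \<in> vectors" if "x \<in> vectors" using that by (rule vectors_left)
    show "(\<lambda>c. x (star (b + b') * c)) = (\<lambda>c. x (star b * c) + x (star b' * c))" if "x \<in> vectors"
      by (simp add: star_add distrib_right vectors_conj_linear[OF that])
    show "(\<lambda>c. x (star (a *\<^sub>C b) * c)) = (\<lambda>c. a *\<^sub>C x (star b * c))" if "x \<in> vectors"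
      by (simp add: star_scaleC mult_scaleC_left vectors_conj_linear[OF that])
    show "(\<lambda>c. x (star (b * b') * c)) = (\<lambda>c. x (star b' * (star b * c)))"
      by (simp add: star_mult mult.assoc)
    show "(\<lambda>c. x (star 1 * c)) = x" by simp
    show "inner_prod x (\<lambda>c. y (star b * c)) = inner_prod (\<lambda>c. x (star (star b) * c)) y"
      if xy: "x \<in> vectors" "y \<in> vectors"
    proof -
      obtain p \<epsilon> where p: "approx x p \<epsilon>" using xy(1) by (rule vectorsE)
      show ?thesis
        by (rule inner_prod_eqI[OF p vectors_left[OF xy(2)]], unfold pairing_left_mul[symmetric])
           (rule pairing_tendsto_inner_prod[OF approx_left[OF p] xy(2)])
    qed
  qed
qed

lemma gns_cyclic_vector:
  obtains \<zeta> where "\<zeta> \<in> carrier gns" "\<And>b. ip gns \<zeta> (lact gns b \<zeta>) = \<phi> b"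
proof
  \<comment> \<open>The vector \<open>1 \<zeta> 1\<close>, that is, the function sending
    \<open>c\<close> to \<open>\<phi> (star c)\<close>.\<close>
  let ?z = "span_fun [(1, 1)]"
  show "?z \<in> carrier gns" by (simp add: vectors_span_fun)
  show "ip gns ?z (lact gns b ?z) = \<phi> b" for b
    unfolding gns_sel
    by (rule inner_prod_eqI[OF approx_span_fun vectors_left[OF vectors_span_fun]]) simp
qed

end

section \<open>Christensen-Evans generators give spatial semigroups\<close>

lemma (in hilbert_module) ip_zero_right: "x \<in> carrier F \<Longrightarrow> ip F x \<zero> = 0"
  using ip_add[of x \<zero> \<zero>] by simp

lemma (in hilbert_module) ip_ract_left:
  "x \<in> carrier F \<Longrightarrow> y \<in> carrier F \<Longrightarrow> ip F (ract F x b) y = star b * ip F x y"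
  by (metis ip_ract ip_star ract_closed star_mult)

text \<open>The double sum is the inner product of the sum of all \<open>v i\<close> with
  itself.\<close>

lemma (in hilbert_module) ip_gram_pos:
  fixes v :: "nat \<Rightarrow> 'f"
  assumes v: "\<And>i. v i \<in> carrier F"
  shows "cstar_pos (\<Sum>i<n. \<Sum>j<n. ip F (v i) (v j))"
proof -
  define w where "w = rec_nat \<zero> (\<lambda>k z. z \<oplus> v k)"
  have w: "w n \<in> carrier F" for n by (induction n) (auto simp: w_def v)
  have right: "ip F y (w n) = (\<Sum>j<n. ip F y (v j))" if y: "y \<in> carrier F" for y n
  proof (induction n)
    case (Suc n)
    have "w (Suc n) = w n \<oplus> v n" by (simp add: w_def)
    then show ?case using Suc ip_add[OF y w v] by simp
  qed (simp add: w_def ip_zero_right[OF y])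
  have "ip F (w n) (w n) = (\<Sum>j<n. star (ip F (v j) (w n)))"
    unfolding right[OF w] using ip_star[OF v w] by simp
  also have "\<dots> = (\<Sum>j<n. \<Sum>i<n. ip F (v i) (v j))" by (simp add: right[OF v] star_sum ip_star v)
  also have "\<dots> = (\<Sum>i<n. \<Sum>j<n. ip F (v i) (v j))" by (rule sum.swap)
  finally show ?thesis using ip_pos[OF w] by metis
qed

lemma (in correspondence) vector_state_form_pos:
  assumes \<zeta>: "\<zeta> \<in> carrier F"
  shows "form_pos n (\<lambda>i j. ip F \<zeta> (lact F (star (a i) * a j) \<zeta>))"
  unfolding form_pos_def
proof
  fix x
  have "ip F (ract F (lact F (a i) \<zeta>) (x i)) (ract F (lact F (a j) \<zeta>) (x j))
      = star (x i) * ip F \<zeta> (lact F (star (a i) * a j) \<zeta>) * x j" for i j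
    using lact_adjoint[OF \<zeta>, of "lact F (a j) \<zeta>" "star (a i)"] \<zeta>
    by (simp add: ip_ract_left ip_ract lact_closed ract_closed lact_mult mult.assoc)
  then show "cstar_pos (mat_form n (\<lambda>i j. ip F \<zeta> (lact F (star (a i) * a j) \<zeta>)) x x)"
    using ip_gram_pos[of "\<lambda>i. ract F (lact F (a i) \<zeta>) (x i)" n] \<zeta>
    by (simp add: mat_form_def lact_closed ract_closed)
qed

section \<open>Linearity and local bounds of CP-semigroups\<close>

lemma cp_semigroup_simps:
  assumes "cp_semigroup T"
  shows "t \<ge> 0 \<Longrightarrow> completely_positive (T t)" "t \<ge> 0 \<Longrightarrow> complex_linear (T t)" "T 0 b = b"
    "s \<ge> 0 \<Longrightarrow> t \<ge> 0 \<Longrightarrow> T (s + t) b = T s (T t b)"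
  using assms by (auto simp: cp_semigroup_def completely_positive_def)

lemma cp_semigroup_linear: "cp_semigroup T \<Longrightarrow> t \<ge> 0 \<Longrightarrow> linear (T t)"
  by (intro complex_linear_imp_linear cp_semigroup_simps(2))

lemma cp_semigroup_bounded_linear:
  assumes "cp_semigroup T" "t \<ge> 0" shows "bounded_linear (T t)"
proof (rule bounded_linear_intro)
  interpret linear "T t" by (rule cp_semigroup_linear[OF assms])
  show "T t (x + y) = T t x + T t y" "T t (r *\<^sub>R x) = r *\<^sub>R T t x" for x y r by (simp_all add: add scale)
  show "norm (T t x) \<le> norm x * (2 * norm (T t 1))" for x
    using completely_positive_bound[OF cp_semigroup_simps(1)[OF assms], of x] by (simp add: mult.commute)
qed

text \<open>The value at 1 controls a positive map, so continuity of the single orbit of 1 on a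
  compact interval suffices.\<close>

lemma cp_semigroup_locally_bounded:
  assumes T: "cp_semigroup T" and cont: "strongly_continuous T"
  obtains M where "M > 0" "\<And>t x. 0 \<le> t \<Longrightarrow> t \<le> \<tau> \<Longrightarrow> norm (T t x) \<le> M * norm x"
proof -
  have "compact ((\<lambda>t. T t 1) ` {0..\<tau>})"
    using cont by (intro compact_continuous_image) (auto simp: strongly_continuous_def intro: continuous_on_subset)
  then obtain B where B: "B > 0" "\<And>t. t \<in> {0..\<tau>} \<Longrightarrow> norm (T t 1) \<le> B"
    using compact_imp_bounded bounded_pos by (metis image_eqI)
  show thesis
  proof (rule that[of "2 * B"])
    fix t x assume t: "0 \<le> t" "t \<le> \<tau>"
    have "norm (T t x) \<le> 2 * norm (T t 1) * norm x"
      by (intro completely_positive_bound cp_semigroup_simps T t)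
    also have "\<dots> \<le> 2 * B * norm x" using B(2)[of t] t by (intro mult_right_mono) auto
    finally show "norm (T t x) \<le> 2 * B * norm x" .
  qed (use B in simp)
qed

lemma complex_linear_remainder:
  assumes "cp_semigroup T" "t \<ge> 0" shows "complex_linear (\<lambda>b. T t b - star u * b * u)"
  using cp_semigroup_simps(2)[OF assms]
  by (simp add: complex_linear_def algebra_simps mult_scaleC_left mult_scaleC_right scaleC_diff_right)

text \<open>With \<open>h s = star (c (t - s)) * b * c (t - s)\<close>, the path \<open>s \<mapsto> T s (h s)\<close> leads from
  \<open>star (c t) * b * c t\<close> to \<open>T t b\<close>, and by the form of the generator its derivative is \<open>T s \<langle>\<zeta>, h s \<zeta>\<rangle>\<close>.\<close>

lemma christensen_evans_imp_spatial:
  fixes T :: "real \<Rightarrow> 'b::cstar_algebra \<Rightarrow> 'b"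
  assumes T: "cp_semigroup T" and cont: "strongly_continuous T"
    and ce: "has_christensen_evans_generator TYPE('f) T"
  shows "spatial T"
proof -
  obtain F :: "('b, 'f) bimodule" and \<zeta> \<beta> where F: "correspondence F" and \<zeta>: "\<zeta> \<in> carrier F"
    and gen: "is_generator (\<lambda>b. ip F \<zeta> (lact F b \<zeta>) + b * \<beta> + star \<beta> * b) T"
    using ce by (auto simp: has_christensen_evans_generator_def)
  define \<phi> where "\<phi> b = ip F \<zeta> (lact F b \<zeta>)" for b
  define c where "c t = exp (t *\<^sub>R \<beta>)" for t :: real
  have \<phi>: "form_pos n (\<lambda>i j. \<phi> (star (a i) * a j))" for n a
    unfolding \<phi>_def by (rule correspondence.vector_state_form_pos[OF F \<zeta>])
  have c0: "c 0 = 1" by (simp add: c_def)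
  have cadd: "c (s + t) = c s * c t" for s t
    unfolding c_def by (simp add: scaleR_add_left exp_add_commuting)
  have cd: "(c has_vector_derivative c t * \<beta>) (at t within A)" for t A
    unfolding c_def by (rule exp_scaleR_has_vector_derivative_right)
  have ccont: "continuous_on A c" for A
    using has_vector_derivative_continuous[OF cd] by (simp add: continuous_on_eq_continuous_within)
  have "completely_positive (\<lambda>b. T t b - star (c t) * b * c t)" if t: "t \<ge> 0" for t
    unfolding completely_positive_iff[OF complex_linear_remainder[OF T t]] form_pos_def
  proof (intro allI)
    fix n and a x :: "nat \<Rightarrow> 'b"
    obtain M where M: "M > 0" "\<And>s y. 0 \<le> s \<Longrightarrow> s \<le> t \<Longrightarrow> norm (T s y) \<le> M * norm y"
      using cp_semigroup_locally_bounded[OF T cont] by blast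
    \<comment> \<open>Conjugation by \<open>c (t - s)\<close> is absorbed into the
      \<open>a i\<close>, so that \<open>?h\<close> keeps the shape on which complete positivity of
      \<open>\<phi>\<close> is tested.\<close>
    let ?y = "\<lambda>s i. a i * c (t - s)"
    let ?h = "\<lambda>i j s. star (?y s i) * ?y s j"
    have h: "((\<lambda>s. T s (?h i j s)) has_vector_derivative T s (\<phi> (?h i j s))) (at s within {0..t})"
      if s: "s \<in> {0..t}" for i j s
    proof -
      have "((\<lambda>s. t - s) has_vector_derivative - 1) (at s within {0..t})"
        by (auto intro!: derivative_eq_intros)
      from vector_diff_chain_within[OF this cd]
      have "((\<lambda>s. c (t - s)) has_vector_derivative - (c (t - s) * \<beta>)) (at s within {0..t})"
        by (simp add: o_def)
      then have y: "((\<lambda>s. ?y s i) has_vector_derivative - (?y s i * \<beta>)) (at s within {0..t})" for i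
        using bounded_linear.has_vector_derivative[OF bounded_linear_mult_right] by (fastforce simp: mult.assoc)
      have "(?h i j has_vector_derivative star (?y s i) * (- (?y s j * \<beta>)) + star (- (?y s i * \<beta>)) * ?y s j)
          (at s within {0..t})"
        by (intro has_vector_derivative_mult bounded_linear.has_vector_derivative[OF bounded_linear_star] y)
      \<comment> \<open>This is exactly the negative of the \<open>\<beta>\<close> terms of the
        generator at \<open>?h i j s\<close>; only \<open>\<phi>\<close> survives in the product
        rule.\<close>
      then have "(?h i j has_vector_derivative - (?h i j s * \<beta> + star \<beta> * ?h i j s)) (at s within {0..t})"
        by (simp add: star_mult mult.assoc)
      from semigroup_product_derivative[of T t M "\<lambda>b. \<phi> b + b * \<beta> + star \<beta> * b", OF _ _ _ _ _ _ s this]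
      show ?thesis
        using T cont gen M(2)
        by (simp add: cp_semigroup_linear cp_semigroup_simps strongly_continuous_def is_generator_def \<phi>_def add.assoc)
    qed
    let ?Q = "\<lambda>s. mat_form n (\<lambda>i j. T s (?h i j s)) x x"
    have "((\<lambda>s. mat_form n (\<lambda>i j. T s (\<phi> (?h i j s))) x x) has_integral (?Q t - ?Q 0)) {0..t}"
    proof (rule fundamental_theorem_of_calculus[OF t])
      fix s assume s: "s \<in> {0..t}"
      have "((\<lambda>s. star (x i) * T s (?h i j s) * x j) has_vector_derivative star (x i) * T s (\<phi> (?h i j s)) * x j)
          (at s within {0..t})" for i j
        by (intro bounded_linear.has_vector_derivative[OF bounded_linear_mult_left]
            bounded_linear.has_vector_derivative[OF bounded_linear_mult_right] h s)
      then show "(?Q has_vector_derivative mat_form n (\<lambda>i j. T s (\<phi> (?h i j s))) x x) (at s within {0..t})"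
        unfolding mat_form_def by (intro has_vector_derivative_sum)
    qed
    moreover have "cstar_pos (mat_form n (\<lambda>i j. T s (\<phi> (?h i j s))) x x)" if "s \<in> {0..t}" for s
    proof (rule form_posD)
      have "matrix_pos n (\<lambda>i j. \<phi> (?h i j s))" unfolding matrix_pos_iff_form_pos by (rule \<phi>)
      then show "form_pos n (\<lambda>i j. T s (\<phi> (?h i j s)))"
        using cp_semigroup_simps(1)[OF T, of s] that
        by (simp add: completely_positive_def matrix_pos_iff_form_pos)
    qed
    ultimately have "cstar_pos (?Q t - ?Q 0)" by (rule cstar_pos_integral)
    also have "?Q t - ?Q 0 = mat_form n (\<lambda>i j. T t (star (a i) * a j) - star (c t) * (star (a i) * a j) * c t) x x"
      by (simp add: c0 cp_semigroup_simps(3)[OF T] mat_form_def sum_subtractf[symmetric] star_mult algebra_simps)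
    finally show "cstar_pos \<dots>" .
  qed
  then show ?thesis unfolding spatial_def using c0 cadd ccont by blast
qed

section \<open>Spatial semigroups have Christensen-Evans generators\<close>

lemma spatial_near_identity:
  fixes T :: "real \<Rightarrow> 'b::cstar_algebra \<Rightarrow> 'b"
  assumes T: "cp_semigroup T" and cont: "strongly_continuous T"
    and c: "c 0 = 1" "continuous_on {0..} c"
    and cp: "\<And>t. t \<ge> 0 \<Longrightarrow> completely_positive (\<lambda>b. T t b - star (c t) * b * c t)"
    and e: "e > 0"
  obtains \<delta> where "\<delta> > 0" "\<And>t b. 0 \<le> t \<Longrightarrow> t \<le> \<delta> \<Longrightarrow> norm (T t b - b) \<le> e * norm b"
    "\<And>t. 0 \<le> t \<Longrightarrow> t \<le> \<delta> \<Longrightarrow> norm (c t - 1) \<le> e"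
proof -
  \<comment> \<open>Relative to \<open>norm b\<close>, the first term bounds the completely positive
    difference and the second the distance of \<open>star (c t) * b * c t\<close> from
    \<open>b\<close>. The second also dominates \<open>norm (c t - 1)\<close>, and
    \<open>?g 0 = 0\<close>.\<close>
  let ?g = "\<lambda>t. 2 * norm (T t 1 - star (c t) * c t) + (norm (c t) + 1) * norm (c t - 1)"
  have "continuous_on {0..} ?g"
    using cont by (intro continuous_intros continuous_on_star c) (auto simp: strongly_continuous_def)
  then have "\<exists>d>0. \<forall>t\<in>{0..}. dist t 0 < d \<longrightarrow> dist (?g t) (?g 0) < e"
    using e unfolding continuous_on_iff by force
  then obtain d where d: "d > 0" "\<And>t. 0 \<le> t \<Longrightarrow> t < d \<Longrightarrow> ?g t < e"
    by (auto simp: c cp_semigroup_simps(3)[OF T] dist_real_def)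
  show thesis
  proof (rule that[of "d / 2"])
    fix t b assume t: "0 \<le> t" "t \<le> d / 2"
    have g: "?g t < e" using t d by (intro d(2)) auto
    have "norm (star (c t) * b * c t - b) \<le> (norm (c t) + 1) * norm (c t - 1) * norm b"
    proof -
      have "star (c t) * b * c t - b = star (c t) * b * (c t - 1) + star (c t - 1) * b"
        by (simp add: star_diff algebra_simps)
      also have "norm \<dots> \<le> norm (c t) * norm b * norm (c t - 1) + norm (c t - 1) * norm b"
        by (intro norm_triangle_mono order.trans[OF norm_mult_ineq] mult_mono) (auto intro: order.trans[OF norm_mult_ineq])
      finally show ?thesis by (simp add: algebra_simps)
    qed
    moreover have "norm (T t b - star (c t) * b * c t) \<le> 2 * norm (T t 1 - star (c t) * c t) * norm b"
      using completely_positive_bound[OF cp[OF t(1)], of b] by simp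
    ultimately have "norm (T t b - b) \<le> ?g t * norm b"
      using norm_triangle_ineq[of "T t b - star (c t) * b * c t" "star (c t) * b * c t - b"]
      by (simp add: distrib_right)
    also have "\<dots> \<le> e * norm b" using g by (intro mult_right_mono) auto
    finally show "norm (T t b - b) \<le> e * norm b" .
  next
    fix t assume t: "0 \<le> t" "t \<le> d / 2"
    have "1 * norm (c t - 1) \<le> (norm (c t) + 1) * norm (c t - 1)" by (intro mult_right_mono) auto
    also have "\<dots> \<le> ?g t" by simp
    finally show "norm (c t - 1) \<le> e" using d(2)[of t] t d(1) by simp
  qed (use d in simp)
qed

text \<open>Since \<open>T (u + v) - T u\<close> is \<open>T u\<close> applied after
  \<open>T v - id\<close>, the local bound spreads the estimate near 0 to every time; starting from
  the smaller of the two times covers both sides.\<close>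

lemma uniformly_continuousI:
  fixes T :: "real \<Rightarrow> 'b::cstar_algebra \<Rightarrow> 'b"
  assumes T: "cp_semigroup T" and cont: "strongly_continuous T"
    and near: "\<And>e. e > 0 \<Longrightarrow> \<exists>\<delta>>0. \<forall>t b. 0 \<le> t \<longrightarrow> t \<le> \<delta> \<longrightarrow> norm (T t b - b) \<le> e * norm b"
  shows "uniformly_continuous T"
  unfolding uniformly_continuous_def
proof (intro conjI allI impI)
  show bl: "bounded_linear (T t)" if "t \<ge> 0" for t using T that by (rule cp_semigroup_bounded_linear)
  show "continuous_on {0..} (\<lambda>t. Blinfun (T t))"
    unfolding continuous_on_iff
  proof (intro ballI allI impI)
    fix t e :: real assume t: "t \<in> {0..}" and e: "e > 0"
    obtain M where M: "M > 0" "\<And>s x. 0 \<le> s \<Longrightarrow> s \<le> t + 1 \<Longrightarrow> norm (T s x) \<le> M * norm x"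
      using cp_semigroup_locally_bounded[OF T cont] by blast
    obtain \<delta> where \<delta>: "\<delta> > 0" "\<And>s b. 0 \<le> s \<Longrightarrow> s \<le> \<delta> \<Longrightarrow> norm (T s b - b) \<le> e / (2 * M) * norm b"
      using near[of "e / (2 * M)"] e M by auto
    have diff: "norm (T (u + v) x - T u x) \<le> e / 2 * norm x"
      if "0 \<le> u" "u \<le> t + 1" "0 \<le> v" "v \<le> \<delta>" for u v x
    proof -
      have "norm (T (u + v) x - T u x) = norm (T u (T v x - x))"
        using that cp_semigroup_linear[OF T that(1)] by (simp add: cp_semigroup_simps[OF T] linear_diff)
      also have "\<dots> \<le> M * norm (T v x - x)" using that by (intro M) auto
      also have "\<dots> \<le> M * (e / (2 * M) * norm x)" using that M by (intro mult_left_mono \<delta>) auto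
      also have "\<dots> = e / 2 * norm x" using M by simp
      finally show ?thesis .
    qed
    have "dist (Blinfun (T s)) (Blinfun (T t)) < e" if s: "s \<in> {0..}" "dist s t < min \<delta> 1" for s
    proof -
      have "norm (Blinfun (T s) - Blinfun (T t)) \<le> e / 2"
      proof (rule norm_blinfun_bound)
        fix x
        have "norm (T s x - T t x) \<le> e / 2 * norm x"
        proof (cases "s \<le> t")
          case True
          then show ?thesis using diff[of s "t - s" x] s t by (simp add: dist_real_def norm_minus_commute)
        next
          case False
          then show ?thesis using diff[of t "s - t" x] s t by (simp add: dist_real_def)
        qed
        then show "norm (blinfun_apply (Blinfun (T s) - Blinfun (T t)) x) \<le> e / 2 * norm x"
          using s t by (simp add: minus_blinfun.rep_eq bounded_linear_Blinfun_apply bl)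
      qed (use e in simp)
      then show ?thesis using e by (simp add: dist_norm)
    qed
    then show "\<exists>d>0. \<forall>s\<in>{0..}. dist s t < d \<longrightarrow> dist (Blinfun (T s)) (Blinfun (T t)) < e"
      using \<delta>(1) by (intro exI[of _ "min \<delta> 1"]) auto
  qed
qed

lemma spatial_imp_christensen_evans:
  fixes T :: "real \<Rightarrow> 'b::cstar_algebra \<Rightarrow> 'b"
  assumes T: "cp_semigroup T" and cont: "strongly_continuous T" and sp: "spatial T"
  shows "has_christensen_evans_generator TYPE('b \<Rightarrow> 'b) T"
proof -
  obtain c where c0: "c 0 = 1" and cadd: "\<And>s t. s \<ge> 0 \<Longrightarrow> t \<ge> 0 \<Longrightarrow> c (s + t) = c s * c t"
    and ccont: "continuous_on {0..} c"
    and cp: "\<And>t. t \<ge> 0 \<Longrightarrow> completely_positive (\<lambda>b. T t b - star (c t) * b * c t)"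
    using sp by (auto simp: spatial_def)
  note near = spatial_near_identity[OF T cont c0 ccont cp]
  have uc: "uniformly_continuous T"
  proof (rule uniformly_continuousI[OF T cont])
    fix e :: real assume "e > 0"
    then show "\<exists>\<delta>>0. \<forall>t b. 0 \<le> t \<longrightarrow> t \<le> \<delta> \<longrightarrow> norm (T t b - b) \<le> e * norm b"
      by (rule near[rotated]) blast+
  qed
  obtain \<delta> where \<delta>: "\<delta> > 0" "\<And>t b. 0 \<le> t \<Longrightarrow> t \<le> \<delta> \<Longrightarrow> norm (T t b - b) \<le> 1/2 * norm b"
    "\<And>t. 0 \<le> t \<Longrightarrow> t \<le> \<delta> \<Longrightarrow> norm (c t - 1) \<le> 1/2"
    by (rule near[of "1/2"]) auto
  have "\<exists>l. ((\<lambda>t. T t b) has_vector_derivative l) (at 0 within {0..})" for b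
  proof (rule semigroup_differentiable[of T \<delta> b])
    show "continuous_on {0..} (\<lambda>t. T t x)" for x using cont by (simp add: strongly_continuous_def)
  qed (use \<delta> in \<open>auto simp: cp_semigroup_simps[OF T] cp_semigroup_bounded_linear[OF T]\<close>)
  then obtain L where L: "\<And>b. ((\<lambda>t. T t b) has_vector_derivative L b) (at 0 within {0..})" by metis
  \<comment> \<open>The unit \<open>c\<close> is the orbit of 1 under the operator semigroup of left
    multiplications by \<open>c t\<close>.\<close>
  have "\<exists>\<beta>. ((\<lambda>t. c t * 1) has_vector_derivative \<beta>) (at 0 within {0..})"
  proof (rule semigroup_differentiable[of "\<lambda>t x. c t * x" \<delta> 1])
    show "norm (c t * x - x) \<le> norm x / 2" if "0 \<le> t" "t \<le> \<delta>" for t x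
    proof -
      have "norm (c t * x - x) = norm ((c t - 1) * x)" by (simp add: left_diff_distrib)
      also have "\<dots> \<le> norm (c t - 1) * norm x" by (rule norm_mult_ineq)
      also have "\<dots> \<le> 1/2 * norm x" using \<delta>(3)[OF that] by (intro mult_right_mono) auto
      finally show ?thesis by simp
    qed
  qed (use \<delta> in \<open>auto simp: cadd mult.assoc bounded_linear_mult_right intro!: continuous_intros ccont\<close>)
  then obtain \<beta> where \<beta>: "(c has_vector_derivative \<beta>) (at 0 within {0..})" by auto
  define S where "S t b = T t b - star (c t) * b * c t" for t b
  define \<phi> where "\<phi> b = L b - (b * \<beta> + star \<beta> * b)" for b
  have S_deriv: "((\<lambda>t. inverse t *\<^sub>R S t b) \<longlongrightarrow> \<phi> b) (at 0 within {0..})" for b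
  proof -
    have "((\<lambda>t. star (c t) * b * c t) has_vector_derivative star (c 0) * b * \<beta> + star \<beta> * b * c 0) (at 0 within {0..})"
      by (intro has_vector_derivative_mult bounded_linear.has_vector_derivative[OF bounded_linear_star]
          bounded_linear.has_vector_derivative[OF bounded_linear_mult_left] \<beta>)
    from has_vector_derivative_diff[OF L[of b] this]
    have "((\<lambda>t. S t b) has_vector_derivative \<phi> b) (at 0 within {0..})" by (simp add: S_def \<phi>_def c0)
    then show ?thesis
      unfolding has_vector_derivative_iff_tendsto by (simp add: S_def c0 cp_semigroup_simps(3)[OF T])
  qed
  have "at_right (0::real) \<le> at 0 within {0..}" by (rule at_le) auto
  then have nontriv: "at (0::real) within {0..} \<noteq> bot" by (metis le_bot trivial_limit_at_right_real)
  have ev: "eventually (\<lambda>t. t \<ge> 0) (at (0::real) within {0..})" by (simp add: eventually_at_filter)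
  have S_lin: "complex_linear (S t)" if "t \<ge> 0" for t
    unfolding S_def by (rule complex_linear_remainder[OF T that])
  have "cp_map \<phi>"
  proof
    show "complex_linear \<phi>" unfolding complex_linear_def
    proof (intro conjI allI)
      fix x y
      have "((\<lambda>t. inverse t *\<^sub>R S t (x + y)) \<longlongrightarrow> \<phi> x + \<phi> y) (at 0 within {0..})"
        by (rule Lim_transform_eventually[OF tendsto_add[OF S_deriv[of x] S_deriv[of y]]])
           (use ev in \<open>eventually_elim, simp add: complex_linear_add[OF S_lin] scaleR_add_right\<close>)
      then show "\<phi> (x + y) = \<phi> x + \<phi> y" using tendsto_unique[OF nontriv S_deriv] by blast
    next
      fix a x
      have "((\<lambda>t. inverse t *\<^sub>R S t (a *\<^sub>C x)) \<longlongrightarrow> a *\<^sub>C \<phi> x) (at 0 within {0..})"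
        by (rule Lim_transform_eventually[OF bounded_linear.tendsto[OF bounded_linear_scaleC S_deriv[of x]]])
           (use ev in \<open>eventually_elim, simp add: complex_linear_scaleC[OF S_lin] scaleC_scaleR\<close>)
      then show "\<phi> (a *\<^sub>C x) = a *\<^sub>C \<phi> x" using tendsto_unique[OF nontriv S_deriv] by blast
    qed
    show "form_pos n (\<lambda>i j. \<phi> (star (a i) * a j))" for n a
      unfolding form_pos_def
    proof
      fix x
      \<comment> \<open>The forms converge and the cone is closed, so positivity is inherited
        without any control on the factors in \<open>matrix_pos\<close>.\<close>
      have "((\<lambda>t. mat_form n (\<lambda>i j. inverse t *\<^sub>R S t (star (a i) * a j)) x x)
          \<longlongrightarrow> mat_form n (\<lambda>i j. \<phi> (star (a i) * a j)) x x) (at 0 within {0..})"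
        unfolding mat_form_def by (intro tendsto_intros S_deriv)
      moreover have "eventually (\<lambda>t. cstar_pos (mat_form n (\<lambda>i j. inverse t *\<^sub>R S t (star (a i) * a j)) x x)) (at 0 within {0..})"
        using ev
      proof eventually_elim
        case (elim t)
        have "mat_form n (\<lambda>i j. inverse t *\<^sub>R S t (star (a i) * a j)) x x
            = inverse t *\<^sub>R mat_form n (\<lambda>i j. S t (star (a i) * a j)) x x"
          by (simp add: mat_form_def scaleR_sum_right)
        moreover have "completely_positive (S t)" unfolding S_def by (rule cp[OF elim])
        ultimately show ?case
          using completely_positive_iff[OF S_lin[OF elim]] elim by (auto intro!: cstar_pos_scaleR form_posD)
      qed
      ultimately show "cstar_pos (mat_form n (\<lambda>i j. \<phi> (star (a i) * a j)) x x)"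
        using nontriv by (rule cstar_pos_limit)
    qed
  qed
  then interpret cp_map \<phi> .
  obtain \<zeta> where \<zeta>: "\<zeta> \<in> carrier gns" "\<And>b. ip gns \<zeta> (lact gns b \<zeta>) = \<phi> b" by (rule gns_cyclic_vector) blast
  have "is_generator (\<lambda>b. ip gns \<zeta> (lact gns b \<zeta>) + b * \<beta> + star \<beta> * b) T"
    unfolding is_generator_def \<zeta>(2) using L by (simp add: \<phi>_def)
  with uc gns_correspondence \<zeta>(1) show ?thesis unfolding has_christensen_evans_generator_def by blast
qed

(* The first conjunct is the equivalence, with the correspondence found among those whose elements
   are functions from the algebra to itself: a large enough universe, since a correspondence
   generated by zeta embeds into it by sending x to (\<lambda>b. ip F (lact F b zeta) x).
   The second conjunct is the "if" direction for correspondences over an arbitrary type 'f. *)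
theorem corollary4p7:
  fixes T :: "real \<Rightarrow> 'b::cstar_algebra \<Rightarrow> 'b"
  assumes "cp_semigroup T" and "strongly_continuous T"
  shows "(spatial T \<longleftrightarrow> has_christensen_evans_generator TYPE('b \<Rightarrow> 'b) T) \<and>
         (has_christensen_evans_generator TYPE('f) T \<longrightarrow> spatial T)"
proof (intro conjI iffI impI)
  show "has_christensen_evans_generator TYPE('b \<Rightarrow> 'b) T" if "spatial T"
    using assms that by (rule spatial_imp_christensen_evans)
  show "spatial T" if "has_christensen_evans_generator TYPE('b \<Rightarrow> 'b) T"
    using assms that by (rule christensen_evans_imp_spatial)
  show "spatial T" if "has_christensen_evans_generator TYPE('f) T"
    using assms that by (rule christensen_evans_imp_spatial)
qed

end
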